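(* Let $f:\mathbb{R}^d\to\mathbb{R}$ be $\mu$-strongly convex with $\mu>0$, twice continuously differentiable, with $L_{\mathbf H}$-Lipschitz Hessian. Let $1/3<\rho<1/2$ and let $\mathbf{x}_0\in\mathbb{R}^d$ satisfy $\|\nabla f(\mathbf{x}_0)\|\le r$, where $r=3(1-2\rho)\mu^2/L_{\mathbf H}$. Let $H_0>0$ satisfy $\|\nabla^2 f(\mathbf{x})\|\le H_0$ for all $\mathbf{x}$ with $f(\mathbf{x})\le f(\mathbf{x}_0)$, and put $\kappa=H_0/\mu$. Run FNCR-LS (see context) from $\mathbf{x}_0$ with $\mathbf{H}_k=\nabla^2 f(\mathbf{x}_k)$, where at outer iteration $k$ the inner parameters satisfy $$0\le\omega<\frac{\|\mathbf{g}_k\|L_{\mathbf H}}{2\mu^2}\qquad\text{and}\qquad T\ge\Big\lceil\frac{\sqrt{\kappa}}{2}\ln\Big(\frac{4L_{\mathbf H}}{\|\mathbf{g}_k\|\mu^2}\Big)\Big\rceil.$$ Then FNCR-LS achieves a quadratic convergence rate: with $\delta_k=f(\mathbf{x}_k)-\min f$, $$\delta_{k+1}<\left(\frac{\mu^2}{L_{\mathbf H}}\right)^2\frac{\big(3(1-2\rho)\big)^{2^{k+1}}}{2\mu},$$ implying that in at most $\mathcal{O}\big(\ln(\ln(\mu^3/(L_{\mathbf H}\varepsilon)))\big)$ iterations it achieves $\varepsilon$-suboptimality.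
   Context: $\|\cdot\|$ is the Euclidean/spectral norm; $\mathbf{g}_k=\nabla f(\mathbf{x}_k)$. $f$ is $\mu$-strongly convex if $f(\mathbf{y})\ge f(\mathbf{x})+\langle\nabla f(\mathbf{x}),\mathbf{y}-\mathbf{x}\rangle+\frac{\mu}{2}\|\mathbf{y}-\mathbf{x}\|^2$ for all $\mathbf{x},\mathbf{y}$. $L_{\mathbf H}$-Lipschitz Hessian: $\|\nabla^2f(\mathbf{x})-\nabla^2f(\mathbf{y})\|\le L_{\mathbf H}\|\mathbf{x}-\mathbf{y}\|$ for all $\mathbf{x},\mathbf{y}$. For $0<\varepsilon<1$, a point $\mathbf{x}$ is $\varepsilon$-suboptimal if $f(\mathbf{x})-\min f\le\varepsilon$. Sufficiency: at a point $\mathbf{x}$, a vector $\mathbf{d}$ is $c$-sufficient if $f(\mathbf{x}+\mathbf{d})\le f(\mathbf{x})+c\langle\nabla f(\mathbf{x}),\mathbf{d}\rangle$. Conjugate residual (CR) recursion for $(\mathbf{H},\mathbf{g})$, $\mathbf{H}\succ0$: $\mathbf{s}^{(0)}=\mathbf{0}$, $\mathbf{r}^{(0)}=\mathbf{p}^{(0)}=-\mathbf{g}$; $\alpha^{(t)}=\langle\mathbf{r}^{(t)},\mathbf{H}\mathbf{r}^{(t)}\rangle/\|\mathbf{H}\mathbf{p}^{(t)}\|^2$, $\mathbf{s}^{(t+1)}=\mathbf{s}^{(t)}+\alpha^{(t)}\mathbf{p}^{(t)}$, $\mathbf{r}^{(t+1)}=\mathbf{r}^{(t)}-\alpha^{(t)}\mathbf{H}\mathbf{p}^{(t)}$,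 $\gamma^{(t)}=\langle\mathbf{r}^{(t+1)},\mathbf{H}\mathbf{r}^{(t+1)}\rangle/\langle\mathbf{r}^{(t)},\mathbf{H}\mathbf{r}^{(t)}\rangle$, $\mathbf{p}^{(t+1)}=\mathbf{r}^{(t+1)}+\gamma^{(t)}\mathbf{p}^{(t)}$. Inner solver, at $\mathbf{x}$ with $\mathbf{g}=\nabla f(\mathbf{x})$ and matrix $\mathbf{H}$; parameters: integers $1\le T\le T_{\max}\le d$, $0<\rho<1/2$, $0\le\omega<1$. Let $\rho_0=\rho$, $\rho_t=\rho\|\mathbf{g}\|^2/\|\mathbf{r}^{(t-1)}\|^2$ for $t\ge1$. Start with $t=0$ and loop: if $t\ge T$ and $\mathbf{s}^{(t)}$ is not $\rho_t$-sufficient, exit the loop; otherwise, if $\|\mathbf{r}^{(t)}\|\le\omega\|\mathbf{g}\|$ or $t=T_{\max}$, return $\mathbf{s}^{(t)}$ (type TER); otherwise perform one CR step and set $t\leftarrow t+1$. After exiting the loop: if $t=T$ return $\mathbf{s}^{(t)}$ (type INS), else return $\mathbf{s}^{(t-1)}$ (type SUF). Backtracking with parameters $\rho$ (the same $\rho$) and $0<\zeta<1$: given $\mathbf{s}$, return $\eta\mathbf{s}$ with $\eta=\zeta^j$, $j\ge0$ the smallest integer such that $\zeta^j\mathbf{s}$ is $\rho$-sufficient. FNCR-LS: from $\mathbf{x}_0$, for $k=0,1,2,\dots$ (while $\mathbf{g}_k\neq\mathbf 0$): $\mathbf{s}_k$ is the output of the inner solver at $\mathbf{x}_k$ with $(\mathbf{H}_k,\mathbf{g}_k)$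 (the parameters $T,T_{\max},\omega$ may vary with $k$); $\mathbf{d}_k=\eta\mathbf{s}_k$ is the output of backtracking at $\mathbf{x}_k$; $\mathbf{x}_{k+1}=\mathbf{x}_k+\mathbf{d}_k$.
   Formalization: The lower bound on T is corrected to ⌈(√κ/2) ln(4μ²/(‖g_k‖L_H))⌉; the printed ratio L_H/μ² is inverted, and with it the claim is false (e.g. an ill-conditioned quadratic with small L_H and T=1). *)

theory Defs
  imports "HOL-Analysis.Analysis" "HOL-Library.Landau_Symbols"
begin

section \<open>Gradient, Hessian and function classes\<close>

definition grad :: "(real ^ 'n \<Rightarrow> real) \<Rightarrow> real ^ 'n \<Rightarrow> real ^ 'n" where
  "grad f x = (THE g. GDERIV f x :> g)"

definition hessian :: "(real ^ 'n \<Rightarrow> real) \<Rightarrow> real ^ 'n \<Rightarrow> real ^ 'n ^ 'n" where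
  "hessian f x = jacobian (grad f) (at x)"

abbreviation spectral_norm :: "real ^ 'n ^ 'n \<Rightarrow> real" where
  "spectral_norm A \<equiv> onorm ((*v) A)"

text \<open>The first two conjuncts ensure that \<^const>\<open>grad\<close> and \<^const>\<open>hessian\<close>, which are
  total, are the actual derivatives.\<close>

definition twice_continuously_differentiable :: "(real ^ 'n \<Rightarrow> real) \<Rightarrow> bool" where
  "twice_continuously_differentiable f \<longleftrightarrow>
     (\<forall>x. f differentiable at x) \<and> (\<forall>x. grad f differentiable at x) \<and>
     continuous_on UNIV (hessian f)"

definition strongly_convex :: "real \<Rightarrow> (real ^ 'n \<Rightarrow> real) \<Rightarrow> bool" where
  "strongly_convex \<mu> f \<longleftrightarrow>
     (\<forall>x y. f y \<ge> f x + grad f x \<bullet> (y - x) + \<mu> / 2 * (norm (y - x))\<^sup>2)"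

definition lipschitz_hessian :: "real \<Rightarrow> (real ^ 'n \<Rightarrow> real) \<Rightarrow> bool" where
  "lipschitz_hessian L f \<longleftrightarrow>
     (\<forall>x y. spectral_norm (hessian f x - hessian f y) \<le> L * norm (x - y))"

text \<open>The infimum is a minimum for the strongly convex functions considered here.\<close>

definition suboptimal :: "(real ^ 'n \<Rightarrow> real) \<Rightarrow> real \<Rightarrow> real ^ 'n \<Rightarrow> bool" where
  "suboptimal f \<epsilon> x \<longleftrightarrow> f x - (INF y. f y) \<le> \<epsilon>"

definition sufficient :: "(real ^ 'n \<Rightarrow> real) \<Rightarrow> real ^ 'n \<Rightarrow> real \<Rightarrow> real ^ 'n \<Rightarrow> bool" where
  "sufficient f x c d \<longleftrightarrow> f (x + d) \<le> f x + c * (grad f x \<bullet> d)"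

section \<open>Conjugate residual recursion\<close>

text \<open>The state is the triple of iterate \<open>s\<close>, residual \<open>r\<close> and direction \<open>p\<close>. The quotients
  are genuine for positive definite \<open>H\<close> as long as the residual is nonzero; once it
  vanishes, the solver below performs no further step.\<close>

primrec cr :: "real ^ 'n ^ 'n \<Rightarrow> real ^ 'n \<Rightarrow> nat \<Rightarrow> (real ^ 'n) \<times> (real ^ 'n) \<times> (real ^ 'n)" where
  "cr H g 0 = (0, - g, - g)"
| "cr H g (Suc t) =
     (let (s, r, p) = cr H g t;
          \<alpha> = (r \<bullet> (H *v r)) / (norm (H *v p))\<^sup>2;
          s' = s + \<alpha> *\<^sub>R p;
          r' = r - \<alpha> *\<^sub>R (H *v p);
          \<gamma> = (r' \<bullet> (H *v r')) / (r \<bullet> (H *v r));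
          p' = r' + \<gamma> *\<^sub>R p
      in (s', r', p'))"

definition cr_iterate :: "real ^ 'n ^ 'n \<Rightarrow> real ^ 'n \<Rightarrow> nat \<Rightarrow> real ^ 'n" where
  "cr_iterate H g t = fst (cr H g t)"

definition cr_residual :: "real ^ 'n ^ 'n \<Rightarrow> real ^ 'n \<Rightarrow> nat \<Rightarrow> real ^ 'n" where
  "cr_residual H g t = fst (snd (cr H g t))"

section \<open>Inner solver\<close>

datatype step_type = TER | INS | SUF

definition sufficiency_const ::
    "real \<Rightarrow> real ^ 'n ^ 'n \<Rightarrow> real ^ 'n \<Rightarrow> nat \<Rightarrow> real" where
  "sufficiency_const \<rho> H g t =
     (if t = 0 then \<rho> else \<rho> * (norm g)\<^sup>2 / (norm (cr_residual H g (t - 1)))\<^sup>2)"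

text \<open>The loop is entered with \<open>t = 0\<close>, so the test \<open>t \<ge> Tmax\<close>, which makes the recursion
  terminate for every argument, fires exactly when \<open>t = Tmax\<close>.\<close>

function inner_loop ::
    "(real ^ 'n \<Rightarrow> real) \<Rightarrow> real \<Rightarrow> nat \<Rightarrow> nat \<Rightarrow> real \<Rightarrow> real ^ 'n \<Rightarrow> real ^ 'n ^ 'n \<Rightarrow> nat \<Rightarrow>
     (real ^ 'n) \<times> step_type" where
  "inner_loop f \<rho> T Tmax \<omega> x H t =
     (let g = grad f x in
      if t \<ge> T \<and> \<not> sufficient f x (sufficiency_const \<rho> H g t) (cr_iterate H g t)
      then (if t = T then (cr_iterate H g t, INS) else (cr_iterate H g (t - 1), SUF))
      else if norm (cr_residual H g t) \<le> \<omega> * norm g \<or> t \<ge> Tmax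
      then (cr_iterate H g t, TER)
      else inner_loop f \<rho> T Tmax \<omega> x H (t + 1))"
  by pat_completeness auto
termination
  by (relation "Wellfounded.measure (\<lambda>(f, \<rho>, T, Tmax, \<omega>, x, H, t). Tmax - t)") auto

declare inner_loop.simps [simp del]

definition inner_solver ::
    "(real ^ 'n \<Rightarrow> real) \<Rightarrow> real \<Rightarrow> nat \<Rightarrow> nat \<Rightarrow> real \<Rightarrow> real ^ 'n \<Rightarrow> real ^ 'n ^ 'n \<Rightarrow>
     (real ^ 'n) \<times> step_type" where
  "inner_solver f \<rho> T Tmax \<omega> x H = inner_loop f \<rho> T Tmax \<omega> x H 0"

section \<open>Line search and outer iteration\<close>

definition backtrack ::
    "(real ^ 'n \<Rightarrow> real) \<Rightarrow> real \<Rightarrow> real \<Rightarrow> real ^ 'n \<Rightarrow> real ^ 'n \<Rightarrow> real ^ 'n" where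
  "backtrack f \<rho> \<zeta> x s = \<zeta> ^ (LEAST j. sufficient f x \<rho> (\<zeta> ^ j *\<^sub>R s)) *\<^sub>R s"

text \<open>The matrix used at an iterate \<open>x\<close> is \<open>H x\<close>. A run that has stopped at a stationary
  point is continued as a constant sequence.\<close>

primrec fncr_ls ::
    "(real ^ 'n \<Rightarrow> real) \<Rightarrow> (real ^ 'n \<Rightarrow> real ^ 'n ^ 'n) \<Rightarrow> real \<Rightarrow> real \<Rightarrow>
     (nat \<Rightarrow> nat) \<Rightarrow> (nat \<Rightarrow> nat) \<Rightarrow> (nat \<Rightarrow> real) \<Rightarrow> real ^ 'n \<Rightarrow> nat \<Rightarrow> real ^ 'n" where
  "fncr_ls f H \<rho> \<zeta> T Tmax \<omega> x\<^sub>0 0 = x\<^sub>0"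
| "fncr_ls f H \<rho> \<zeta> T Tmax \<omega> x\<^sub>0 (Suc k) =
     (let x = fncr_ls f H \<rho> \<zeta> T Tmax \<omega> x\<^sub>0 k in
      if grad f x = 0 then x
      else let s = fst (inner_solver f \<rho> (T k) (Tmax k) (\<omega> k) x (H x))
           in x + backtrack f \<rho> \<zeta> x s)"

end

theory Submission
  imports Defs "HOL-Real_Asymp.Real_Asymp"
begin

text \<open>Near the minimizer every conjugate residual iterate \<open>s\<close> passes the sufficiency test with the
  constant \<open>\<rho>\<close>, so backtracking accepts the full step: the residual has a nonnegative inner product
  with \<open>s\<close>, whence the curvature along \<open>s\<close> is at most \<open>- (g \<bullet> s)\<close>, and \<open>norm s \<le> norm g / \<mu>\<close> makes
  the cubic Taylor remainder small enough. The Chebyshev bound for the minimal residual over the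
  Krylov space and the choice of \<open>T\<close> and \<open>\<omega>\<close> give a residual of norm at most
  \<open>L / (2 \<mu>\<^sup>2) (norm g)\<^sup>2\<close>, whatever the exit type of the inner solver. Taylor expansion of the
  gradient adds a second term of this size, so each iteration replaces \<open>L / \<mu>\<^sup>2 norm g\<close> by at
  most its square, and \<open>f x - min f \<le> (norm g)\<^sup>2 / (2 \<mu>)\<close> by strong convexity.\<close>

section \<open>Operator norm, one-sided limits and comparison of derivatives\<close>

lemma norm_matrix_vector_le: "norm (A *v v) \<le> spectral_norm A * norm v" for A :: "real ^ 'n ^ 'n"
  by (intro onorm matrix_vector_mul_bounded_linear)

text \<open>Let \<open>t\<close> tend to \<open>0\<close> from the right. This removes the Taylor
  remainder once an inequality has been divided by \<open>t\<^sup>2\<close>.\<close>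

lemma nonneg_if_nonneg_add_mult:
  fixes a b :: real
  assumes "\<And>t. t > 0 \<Longrightarrow> 0 \<le> a + t * b"
  shows "0 \<le> a"
proof -
  have "((\<lambda>t. a + t * b) \<longlongrightarrow> a + 0 * b) (at_right 0)"
    by (intro tendsto_intros)
  moreover have "eventually (\<lambda>t. 0 \<le> a + t * b) (at_right 0)"
    unfolding eventually_at_right_field using assms by (intro exI[of _ 1]) auto
  ultimately show ?thesis
    using tendsto_lowerbound[of "\<lambda>t. a + t * b" "a + 0 * b" "at_right 0" 0] by simp
qed

text \<open>Monotonicity of \<open>\<psi> - \<phi>\<close>. It takes the place of integrating the
  remainder in the Taylor bounds.\<close>

lemma diff_le_if_derivative_le:
  fixes \<phi> \<psi> :: "real \<Rightarrow> real"
  assumes "a \<le> b"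
    and "\<And>t. a \<le> t \<Longrightarrow> t \<le> b \<Longrightarrow> (\<phi> has_real_derivative \<phi>' t) (at t)"
    and "\<And>t. a \<le> t \<Longrightarrow> t \<le> b \<Longrightarrow> (\<psi> has_real_derivative \<psi>' t) (at t)"
    and "\<And>t. a \<le> t \<Longrightarrow> t \<le> b \<Longrightarrow> \<phi>' t \<le> \<psi>' t"
  shows "\<phi> b - \<phi> a \<le> \<psi> b - \<psi> a"
proof -
  have "(\<lambda>t. \<psi> t - \<phi> t) a \<le> (\<lambda>t. \<psi> t - \<phi> t) b"
  proof (rule DERIV_nonneg_imp_nondecreasing[OF assms(1)])
    fix t assume "a \<le> t" "t \<le> b"
    then show "\<exists>y. ((\<lambda>t. \<psi> t - \<phi> t) has_real_derivative y) (at t) \<and> 0 \<le> y"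
      using assms(2-4) by (intro exI[of _ "\<psi>' t - \<phi>' t"] conjI DERIV_diff) auto
  qed
  then show ?thesis by simp
qed

section \<open>Taylor bounds under a Lipschitz Hessian\<close>

locale hessian_lipschitz =
  fixes f :: "real ^ 'n \<Rightarrow> real" and L :: real
  assumes C2: "twice_continuously_differentiable f"
    and lipschitz: "lipschitz_hessian L f"
begin

text \<open>\<open>grad\<close> is a definite description, so existence and uniqueness are both
  needed. Existence is the Riesz representation of the derivative: its adjoint applied to
  \<open>1\<close>.\<close>

lemma GDERIV_grad: "GDERIV f x :> grad f x"
proof -
  have d: "(f has_derivative frechet_derivative f (at x)) (at x)"
    using C2 by (simp add: twice_continuously_differentiable_def frechet_derivative_works[symmetric])
  define g where "g = adjoint (frechet_derivative f (at x)) 1"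
  have "frechet_derivative f (at x) = (\<lambda>h. h \<bullet> g)"
    using adjoint_works[OF has_derivative_linear[OF d], of _ 1] by (auto simp: g_def)
  then have g: "GDERIV f x :> g"
    using d by (simp add: gderiv_def)
  have "g' = g" if "GDERIV f x :> g'" for g'
  proof -
    have "(\<lambda>h. h \<bullet> g') = (\<lambda>h. h \<bullet> g)"
      using has_derivative_unique that g unfolding gderiv_def by blast
    then have "(g' - g) \<bullet> g' = (g' - g) \<bullet> g"
      by metis
    then have "(g' - g) \<bullet> (g' - g) = 0"
      by (simp add: inner_diff_right)
    then show ?thesis by simp
  qed
  then show ?thesis
    unfolding grad_def using g by (metis (mono_tags, lifting) theI)
qed

lemma has_derivative_grad: "(grad f has_derivative (\<lambda>h. hessian f x *v h)) (at x)"
  using C2 unfolding twice_continuously_differentiable_def hessian_def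
  by (simp add: jacobian_works[symmetric])

lemma grad_line_derivative:
  "((\<lambda>t. u \<bullet> grad f (x + t *\<^sub>R d)) has_real_derivative u \<bullet> (hessian f (x + t *\<^sub>R d) *v d)) (at t)"
proof -
  have "((\<lambda>t. u \<bullet> grad f (x + t *\<^sub>R d)) has_derivative
      (\<lambda>s. u \<bullet> (hessian f (x + t *\<^sub>R d) *v (s *\<^sub>R d)))) (at t)"
    by (intro has_derivative_inner_right has_derivative_compose[OF _ has_derivative_grad])
      (auto intro!: derivative_eq_intros)
  then show ?thesis
    by (simp add: has_field_derivative_def matrix_vector_mult_scaleR mult_commute_abs)
qed

lemma line_derivative:
  "((\<lambda>t. f (x + t *\<^sub>R d)) has_real_derivative grad f (x + t *\<^sub>R d) \<bullet> d) (at t)"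
proof -
  have "((\<lambda>t. f (x + t *\<^sub>R d)) has_derivative (\<lambda>s. (s *\<^sub>R d) \<bullet> grad f (x + t *\<^sub>R d))) (at t)"
    by (rule has_derivative_compose[OF _ GDERIV_grad[unfolded gderiv_def]])
      (auto intro!: derivative_eq_intros)
  then show ?thesis
    by (simp add: has_field_derivative_def inner_commute mult_commute_abs)
qed

lemma hessian_diff_le: "norm ((hessian f x - hessian f y) *v v) \<le> L * norm (x - y) * norm v"
proof -
  have "norm ((hessian f x - hessian f y) *v v) \<le> spectral_norm (hessian f x - hessian f y) * norm v"
    by (rule norm_matrix_vector_le)
  also have "\<dots> \<le> L * norm (x - y) * norm v"
    using lipschitz by (auto simp: lipschitz_hessian_def intro!: mult_right_mono)
  finally show ?thesis .
qed

text \<open>The gradient along the segment, less its linear part, is paired with the error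
  \<open>u\<close> itself. The increment of this real function over \<open>[0, 1]\<close> is
  \<open>norm u * norm u\<close>, and one factor \<open>norm u\<close> cancels.\<close>

lemma grad_taylor: "norm (grad f (x + d) - grad f x - hessian f x *v d) \<le> L / 2 * (norm d)\<^sup>2"
proof -
  define u where "u = grad f (x + d) - grad f x - hessian f x *v d"
  let ?\<phi> = "\<lambda>t. u \<bullet> grad f (x + t *\<^sub>R d) - t * (u \<bullet> (hessian f x *v d))"
  have "?\<phi> 1 - ?\<phi> 0 \<le> L / 2 * (norm d)\<^sup>2 * norm u * 1\<^sup>2 - L / 2 * (norm d)\<^sup>2 * norm u * 0\<^sup>2"
  proof (rule diff_le_if_derivative_le)
    fix t :: real assume t: "0 \<le> t" "t \<le> 1"
    show "(?\<phi> has_real_derivative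
        u \<bullet> (hessian f (x + t *\<^sub>R d) *v d) - u \<bullet> (hessian f x *v d)) (at t)"
      by (rule derivative_eq_intros grad_line_derivative refl | simp)+
    show "((\<lambda>t. L / 2 * (norm d)\<^sup>2 * norm u * t\<^sup>2) has_real_derivative
        L * (norm d)\<^sup>2 * norm u * t) (at t)"
      by (auto intro!: derivative_eq_intros)
    have "u \<bullet> (hessian f (x + t *\<^sub>R d) *v d) - u \<bullet> (hessian f x *v d)
        = u \<bullet> ((hessian f (x + t *\<^sub>R d) - hessian f x) *v d)"
      by (simp add: matrix_vector_mult_diff_rdistrib inner_diff_right)
    also have "\<dots> \<le> norm u * (L * norm (t *\<^sub>R d) * norm d)"
      using hessian_diff_le[of "x + t *\<^sub>R d" x d]
      by (intro order_trans[OF norm_cauchy_schwarz] mult_left_mono) auto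
    also have "\<dots> = L * (norm d)\<^sup>2 * norm u * t"
      using t by (simp add: power2_eq_square)
    finally show "u \<bullet> (hessian f (x + t *\<^sub>R d) *v d) - u \<bullet> (hessian f x *v d)
        \<le> L * (norm d)\<^sup>2 * norm u * t" .
  qed simp
  moreover have "?\<phi> 1 - ?\<phi> 0 = norm u * norm u"
  proof -
    have "?\<phi> 1 - ?\<phi> 0 = u \<bullet> (grad f (x + d) - grad f x - hessian f x *v d)"
      by (simp add: inner_diff_right)
    also have "\<dots> = u \<bullet> u" by (simp only: u_def)
    finally show ?thesis by (simp only: dot_square_norm power2_eq_square)
  qed
  ultimately have "norm u * norm u \<le> L / 2 * (norm d)\<^sup>2 * norm u"
    by simp
  \<comment> \<open>For \<open>u = 0\<close> the claim is just this; the sign of \<open>L\<close>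
    comes from the Lipschitz estimate between \<open>x + d\<close> and \<open>x\<close>.\<close>
  moreover have "0 \<le> L / 2 * (norm d)\<^sup>2"
  proof (cases "d = 0")
    case False
    then have "0 \<le> L * norm d * norm d"
      using order_trans[OF norm_ge_zero hessian_diff_le[of "x + d" x d]] by simp
    then show ?thesis by (simp add: power2_eq_square)
  qed simp
  ultimately have "norm u \<le> L / 2 * (norm d)\<^sup>2"
    using mult_right_le_imp_le[of "norm u" "norm u" "L / 2 * (norm d)\<^sup>2"] by (cases "u = 0") auto
  then show ?thesis by (simp add: u_def)
qed

text \<open>The derivative of the second-order error along the segment is the error in
  \<open>grad_taylor\<close> for the increment \<open>t *\<^sub>R d\<close>, paired with
  \<open>d\<close>. It and its negative are compared with the derivative of a cubic.\<close>

lemma taylor: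
  "\<bar>f (x + d) - (f x + grad f x \<bullet> d + (d \<bullet> (hessian f x *v d)) / 2)\<bar> \<le> L / 6 * norm d ^ 3"
proof -
  let ?q = "d \<bullet> (hessian f x *v d)"
  let ?\<phi> = "\<lambda>t. f (x + t *\<^sub>R d) - (t * (grad f x \<bullet> d) + t\<^sup>2 * ?q / 2)"
  let ?\<phi>' = "\<lambda>t. grad f (x + t *\<^sub>R d) \<bullet> d - (grad f x \<bullet> d + t * ?q)"
  let ?\<psi> = "\<lambda>t::real. L / 6 * norm d ^ 3 * t ^ 3"
  let ?\<psi>' = "\<lambda>t::real. L / 2 * norm d ^ 3 * t\<^sup>2"
  have d\<phi>: "(?\<phi> has_real_derivative ?\<phi>' t) (at t)" for t
    by (rule derivative_eq_intros line_derivative refl | simp)+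
  have d\<psi>: "(?\<psi> has_real_derivative ?\<psi>' t) (at t)" for t
    by (auto intro!: derivative_eq_intros)
  have bound: "\<bar>?\<phi>' t\<bar> \<le> ?\<psi>' t" if "0 \<le> t" for t
  proof -
    have "?\<phi>' t = (grad f (x + t *\<^sub>R d) - grad f x - hessian f x *v (t *\<^sub>R d)) \<bullet> d"
      by (simp add: inner_diff_left matrix_vector_mult_scaleR inner_commute[of d])
    also have "\<bar>\<dots>\<bar> \<le> L / 2 * (norm (t *\<^sub>R d))\<^sup>2 * norm d"
      by (intro order_trans[OF Cauchy_Schwarz_ineq2] mult_right_mono grad_taylor) auto
    also have "\<dots> = ?\<psi>' t"
      by (simp add: power_mult_distrib power2_eq_square power3_eq_cube)
    finally show ?thesis .
  qed
  have "?\<phi> 1 - ?\<phi> 0 \<le> ?\<psi> 1 - ?\<psi> 0"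
    by (rule diff_le_if_derivative_le[OF _ d\<phi> d\<psi>]) (simp_all only: abs_le_D1[OF bound] zero_le_one)
  moreover have "?\<phi> 0 - ?\<phi> 1 \<le> ?\<psi> 1 - ?\<psi> 0"
    using diff_le_if_derivative_le[OF _ DERIV_minus[OF d\<phi>] d\<psi>, of 0 1] abs_le_D2[OF bound]
    by fastforce
  ultimately have "\<bar>?\<phi> 1 - ?\<phi> 0\<bar> \<le> ?\<psi> 1 - ?\<psi> 0"
    by (simp only: abs_le_iff minus_diff_eq)
  then show ?thesis by (simp add: algebra_simps)
qed

text \<open>Expanding \<open>f (x + t u + t v)\<close> to second order once at \<open>x\<close> and once at \<open>x + t u\<close>, the terms of
  order \<open>t\<^sup>2\<close> that are not symmetric in \<open>u\<close> and \<open>v\<close> must cancel.\<close>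

lemma hessian_symmetric: "(hessian f x *v u) \<bullet> v = u \<bullet> (hessian f x *v v)"
proof -
  let ?H = "hessian f x"
  define C where "C = L / 6 * norm (u + v) ^ 3 + L / 6 * norm u ^ 3 + L / 6 * norm v ^ 3
    + L / 2 * (norm u)\<^sup>2 * norm v + L / 2 * norm u * (norm v)\<^sup>2"
  have key: "\<bar>(?H *v u) \<bullet> v - u \<bullet> (?H *v v)\<bar> / 2 \<le> t * C" if t: "t > 0" for t
  proof -
    let ?y = "x + t *\<^sub>R u"
    have 1: "\<bar>f (x + t *\<^sub>R (u + v)) - (f x + t * (grad f x \<bullet> (u + v)) + t\<^sup>2 * ((u + v) \<bullet> (?H *v (u + v))) / 2)\<bar>
        \<le> t ^ 3 * (L / 6 * norm (u + v) ^ 3)"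
      using taylor[of x "t *\<^sub>R (u + v)"] t
      by (simp add: matrix_vector_mult_scaleR power_mult_distrib power2_eq_square mult_ac)
    have 2: "\<bar>f ?y - (f x + t * (grad f x \<bullet> u) + t\<^sup>2 * (u \<bullet> (?H *v u)) / 2)\<bar> \<le> t ^ 3 * (L / 6 * norm u ^ 3)"
      using taylor[of x "t *\<^sub>R u"] t
      by (simp add: matrix_vector_mult_scaleR power_mult_distrib power2_eq_square mult_ac)
    have 3: "\<bar>f (?y + t *\<^sub>R v) - (f ?y + t * (grad f ?y \<bullet> v) + t\<^sup>2 * (v \<bullet> (hessian f ?y *v v)) / 2)\<bar>
        \<le> t ^ 3 * (L / 6 * norm v ^ 3)"
      using taylor[of ?y "t *\<^sub>R v"] t
      by (simp add: matrix_vector_mult_scaleR power_mult_distrib power2_eq_square mult_ac)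
    \<comment> \<open>Estimates 4 and 5 move the gradient and the Hessian at \<open>?y\<close> back
      to \<open>x\<close>, at a cost of order \<open>t ^ 3\<close> each.\<close>
    have "\<bar>(grad f ?y - grad f x - ?H *v (t *\<^sub>R u)) \<bullet> v\<bar> \<le> L / 2 * (norm (t *\<^sub>R u))\<^sup>2 * norm v"
      by (intro order_trans[OF Cauchy_Schwarz_ineq2] mult_right_mono grad_taylor) auto
    then have "t * \<bar>grad f ?y \<bullet> v - grad f x \<bullet> v - t * ((?H *v u) \<bullet> v)\<bar>
        \<le> t * (L / 2 * (norm (t *\<^sub>R u))\<^sup>2 * norm v)"
      using t by (intro mult_left_mono) (auto simp: inner_diff_left matrix_vector_mult_scaleR)
    then have 4: "\<bar>t * (grad f ?y \<bullet> v) - t * (grad f x \<bullet> v) - t\<^sup>2 * ((?H *v u) \<bullet> v)\<bar>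
        \<le> t ^ 3 * (L / 2 * (norm u)\<^sup>2 * norm v)"
      using t by (simp add: abs_mult_pos' right_diff_distrib power2_eq_square power3_eq_cube mult_ac)
    have "\<bar>v \<bullet> ((hessian f ?y - ?H) *v v)\<bar> \<le> norm v * (L * norm (?y - x) * norm v)"
      by (intro order_trans[OF Cauchy_Schwarz_ineq2] mult_left_mono hessian_diff_le) auto
    then have "t\<^sup>2 / 2 * \<bar>v \<bullet> (hessian f ?y *v v) - v \<bullet> (?H *v v)\<bar> \<le> t\<^sup>2 / 2 * (norm v * (L * norm (?y - x) * norm v))"
      by (intro mult_left_mono) (auto simp: matrix_vector_mult_diff_rdistrib inner_diff_right)
    then have 5: "\<bar>t\<^sup>2 * (v \<bullet> (hessian f ?y *v v)) / 2 - t\<^sup>2 * (v \<bullet> (?H *v v)) / 2\<bar> \<le> t ^ 3 * (L / 2 * norm u * (norm v)\<^sup>2)"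
      using t by (simp add: abs_mult_pos' right_diff_distrib power2_eq_square power3_eq_cube mult_ac)
    have "?y + t *\<^sub>R v = x + t *\<^sub>R (u + v)" by (simp add: algebra_simps)
    note bounds = 1 2 3[unfolded this] 4 5
    have "(u + v) \<bullet> (?H *v (u + v)) = u \<bullet> (?H *v u) + u \<bullet> (?H *v v) + (?H *v u) \<bullet> v + v \<bullet> (?H *v v)"
      by (simp add: matrix_vector_right_distrib inner_add_left inner_add_right inner_commute[of v])
    \<comment> \<open>The expansion at \<open>x\<close> has both cross terms with weight one half,
      the one through \<open>?y\<close> only \<open>(?H *v u) \<bullet> v\<close> with weight one.
      Half the asymmetry is left.\<close>
    then have "t\<^sup>2 * ((u + v) \<bullet> (?H *v (u + v))) / 2 - t\<^sup>2 * (u \<bullet> (?H *v u)) / 2 - t\<^sup>2 * (v \<bullet> (?H *v v)) / 2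
        - t\<^sup>2 * ((?H *v u) \<bullet> v) = t\<^sup>2 * ((u \<bullet> (?H *v v) - (?H *v u) \<bullet> v) / 2)"
      by (simp add: field_simps)
    moreover have "t * (grad f x \<bullet> (u + v)) = t * (grad f x \<bullet> u) + t * (grad f x \<bullet> v)"
      by (simp add: inner_add_right algebra_simps)
    ultimately have "\<bar>t\<^sup>2 * ((u \<bullet> (?H *v v) - (?H *v u) \<bullet> v) / 2)\<bar> \<le> t ^ 3 * (L / 6 * norm (u + v) ^ 3)
        + t ^ 3 * (L / 6 * norm u ^ 3) + t ^ 3 * (L / 6 * norm v ^ 3)
        + t ^ 3 * (L / 2 * (norm u)\<^sup>2 * norm v) + t ^ 3 * (L / 2 * norm u * (norm v)\<^sup>2)"
      using bounds[THEN abs_le_D1] bounds[THEN abs_le_D2] by (intro abs_leI) linarith+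
    also have "\<dots> = t\<^sup>2 * (t * C)"
      unfolding C_def by algebra
    finally have "t\<^sup>2 * (\<bar>u \<bullet> (?H *v v) - (?H *v u) \<bullet> v\<bar> / 2) \<le> t\<^sup>2 * (t * C)"
      by (simp add: abs_mult)
    then show ?thesis
      using t by (simp add: abs_minus_commute)
  qed
  have "0 \<le> - (\<bar>(?H *v u) \<bullet> v - u \<bullet> (?H *v v)\<bar> / 2)"
  proof (rule nonneg_if_nonneg_add_mult)
    show "0 \<le> - (\<bar>(?H *v u) \<bullet> v - u \<bullet> (?H *v v)\<bar> / 2) + t * C" if "t > 0" for t
      using key[OF that] by linarith
  qed
  then show ?thesis by simp
qed

text \<open>At \<open>x + t *\<^sub>R v\<close> the strong convexity bound and the Taylor expansion
  agree up to first order. Divide what is left by \<open>t\<^sup>2\<close> and let \<open>t\<close>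
  tend to \<open>0\<close>.\<close>

lemma hessian_coercive:
  assumes "strongly_convex \<mu> f"
  shows "\<mu> * (v \<bullet> v) \<le> v \<bullet> (hessian f x *v v)"
proof -
  let ?q = "v \<bullet> (hessian f x *v v)"
  have "0 \<le> (?q - \<mu> * (v \<bullet> v)) / 2"
  proof (rule nonneg_if_nonneg_add_mult)
    fix t :: real assume t: "t > 0"
    have "f x + grad f x \<bullet> (t *\<^sub>R v) + \<mu> / 2 * (norm (t *\<^sub>R v))\<^sup>2 \<le> f (x + t *\<^sub>R v)"
      using assms unfolding strongly_convex_def by (metis add_diff_cancel_left')
    then have "f x + t * (grad f x \<bullet> v) + t\<^sup>2 * (\<mu> / 2 * (v \<bullet> v)) \<le> f (x + t *\<^sub>R v)"
      by (simp add: power_mult_distrib power2_norm_eq_inner mult_ac)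
    moreover have "\<bar>f (x + t *\<^sub>R v) - (f x + t * (grad f x \<bullet> v) + t\<^sup>2 * ?q / 2)\<bar> \<le> t ^ 3 * (L / 6 * norm v ^ 3)"
      using taylor[of x "t *\<^sub>R v"] t
      by (simp add: matrix_vector_mult_scaleR power_mult_distrib power2_eq_square mult_ac)
    ultimately have "t\<^sup>2 * (\<mu> / 2 * (v \<bullet> v)) \<le> t\<^sup>2 * ?q / 2 + t ^ 3 * (L / 6 * norm v ^ 3)"
      by linarith
    then have "t\<^sup>2 * 0 \<le> t\<^sup>2 * ((?q - \<mu> * (v \<bullet> v)) / 2 + t * (L / 6 * norm v ^ 3))"
      by (simp add: field_simps power2_eq_square power3_eq_cube)
    then show "0 \<le> (?q - \<mu> * (v \<bullet> v)) / 2 + t * (L / 6 * norm v ^ 3)"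
      using t by (subst (asm) mult_le_cancel_left_pos) auto
  qed
  then show ?thesis by simp
qed

end

section \<open>Suboptimality and the gradient under strong convexity\<close>

lemma suboptimality_le:
  assumes "strongly_convex \<mu> f" "\<mu> > 0"
  shows "f x - (INF y. f y) \<le> (norm (grad f x))\<^sup>2 / (2 * \<mu>)"
proof -
  have "f x - (norm (grad f x))\<^sup>2 / (2 * \<mu>) \<le> f y" for y
  proof -
    \<comment> \<open>Completing the square: as a quadratic in \<open>y\<close>, the strong
      convexity bound is least where \<open>grad f x + \<mu> *\<^sub>R (y - x) = 0\<close>.\<close>
    have "0 \<le> (norm (grad f x + \<mu> *\<^sub>R (y - x)))\<^sup>2 / (2 * \<mu>)"
      using assms by simp
    also have "(norm (grad f x + \<mu> *\<^sub>R (y - x)))\<^sup>2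
        = (norm (grad f x))\<^sup>2 + 2 * \<mu> * (grad f x \<bullet> (y - x)) + \<mu>\<^sup>2 * (norm (y - x))\<^sup>2"
      unfolding power2_norm_eq_inner
      by (simp only: inner_add_left inner_add_right inner_scaleR_left inner_scaleR_right
          inner_commute[of "y - x" "grad f x"] power2_eq_square) algebra
    also have "\<dots> / (2 * \<mu>) = (norm (grad f x))\<^sup>2 / (2 * \<mu>) + grad f x \<bullet> (y - x) + \<mu> / 2 * (norm (y - x))\<^sup>2"
      using assms(2) by (simp add: field_simps power2_eq_square)
    finally show ?thesis
      using assms(1) unfolding strongly_convex_def by (smt (verit))
  qed
  then have "f x - (norm (grad f x))\<^sup>2 / (2 * \<mu>) \<le> (INF y. f y)"
    by (intro cINF_greatest) auto
  then show ?thesis by simp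
qed

section \<open>Conjugate residuals\<close>

text \<open>Bounds on the quadratic form stand for bounds on the spectrum, so eigenvalues never
  appear.\<close>

locale spd_matrix =
  fixes H :: "real ^ 'n ^ 'n" and \<mu> M :: real
  assumes symmetric: "\<And>u v. (H *v u) \<bullet> v = u \<bullet> (H *v v)"
    and coercive: "\<And>v. \<mu> * (v \<bullet> v) \<le> v \<bullet> (H *v v)"
    and bounded: "\<And>v. v \<bullet> (H *v v) \<le> M * (v \<bullet> v)"
    and \<mu>_pos: "\<mu> > 0"
begin

lemma pos: "v \<noteq> 0 \<Longrightarrow> v \<bullet> (H *v v) > 0"
  using coercive[of v] \<mu>_pos by (smt (verit) inner_gt_zero_iff mult_pos_pos)

lemma nonneg: "v \<bullet> (H *v v) \<ge> 0"
  using pos[of v] by (cases "v = 0") auto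

lemma mult_eq_0_iff: "H *v v = 0 \<longleftrightarrow> v = 0"
  using pos[of v] by (cases "v = 0") auto

lemma \<mu>_le_M: "\<mu> \<le> M"
proof -
  have "\<mu> * (v \<bullet> v) \<le> M * (v \<bullet> v)" for v :: "real ^ 'n"
    using coercive[of v] bounded[of v] by linarith
  from this[of "axis undefined 1"] show ?thesis by (simp add: inner_axis_axis)
qed

text \<open>For \<open>M > \<mu>\<close>, \<open>shifted\<close> divided by \<open>M - \<mu>\<close>
  has its spectrum in \<open>[-1, 1]\<close>: it is the argument of the Chebyshev
  polynomials.\<close>

definition shifted :: "real ^ 'n \<Rightarrow> real ^ 'n" where
  "shifted v = (M + \<mu>) *\<^sub>R v - 2 *\<^sub>R (H *v v)"

lemma shifted_symmetric: "shifted u \<bullet> v = u \<bullet> shifted v"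
  by (simp add: shifted_def inner_diff_left inner_diff_right symmetric)

lemma linear_shifted: "linear shifted"
  by (rule linearI)
    (simp_all add: shifted_def algebra_simps matrix_vector_right_distrib matrix_vector_mult_scaleR)

text \<open>Polarization turns the bound on the quadratic form into one on the norm.\<close>

lemma norm_shifted_le: "norm (shifted v) \<le> (M - \<mu>) * norm v"
proof -
  have form: "\<bar>v \<bullet> shifted v\<bar> \<le> (M - \<mu>) * (v \<bullet> v)" for v
    using coercive[of v] bounded[of v] by (auto simp: shifted_def inner_diff_right algebra_simps)
  have polar: "2 * (u \<bullet> shifted v) \<le> (M - \<mu>) * (u \<bullet> u + v \<bullet> v)" for u v
  proof -
    have "4 * (u \<bullet> shifted v) = (u + v) \<bullet> shifted (u + v) - (u - v) \<bullet> shifted (u - v)"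
      using shifted_symmetric[of v u] shifted_symmetric[of u v]
      by (simp add: linear_add[OF linear_shifted] linear_diff[OF linear_shifted] inner_add_left inner_add_right inner_diff_left
          inner_diff_right inner_commute)
    also have "\<dots> \<le> (M - \<mu>) * ((u + v) \<bullet> (u + v)) + (M - \<mu>) * ((u - v) \<bullet> (u - v))"
      using form[of "u + v"] form[of "u - v"] by (simp add: abs_le_iff)
    also have "\<dots> = 2 * ((M - \<mu>) * (u \<bullet> u + v \<bullet> v))"
      by (simp add: inner_add_left inner_add_right inner_diff_left inner_diff_right inner_commute algebra_simps)
    finally show ?thesis by simp
  qed
  show ?thesis
  proof (cases "shifted v = 0")
    case False
    define c where "c = norm v / norm (shifted v)"
    have cn: "c * norm (shifted v) = norm v"
      using False by (simp add: c_def)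
    have "2 * (c *\<^sub>R shifted v \<bullet> shifted v) = 2 * (c * norm (shifted v) * norm (shifted v))"
      by (simp add: dot_square_norm power2_eq_square)
    moreover have "c *\<^sub>R shifted v \<bullet> c *\<^sub>R shifted v = (c * norm (shifted v)) * (c * norm (shifted v))"
      by (simp add: dot_square_norm power2_eq_square)
    ultimately have "2 * (norm v * norm (shifted v)) \<le> (M - \<mu>) * (norm v * norm v + norm v * norm v)"
      using polar[of "c *\<^sub>R shifted v" v]
      by (simp only: cn inner_scaleR_left[symmetric] dot_square_norm[of v] power2_eq_square)
    then have "2 * (norm v * norm (shifted v)) \<le> 2 * (norm v * ((M - \<mu>) * norm v))"
      by (simp add: algebra_simps)
    moreover have "v \<noteq> 0" using False linear_0[OF linear_shifted] by auto
    ultimately show ?thesis by simp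
  qed (use \<mu>_le_M in simp)
qed

end

subsection \<open>Krylov optimality\<close>

locale cr_run = spd_matrix H \<mu> M for H :: "real ^ 'n ^ 'n" and \<mu> M +
  fixes g :: "real ^ 'n"
begin

abbreviation "s \<equiv> cr_iterate H g"
abbreviation "r \<equiv> cr_residual H g"

definition p :: "nat \<Rightarrow> real ^ 'n" where "p t = snd (snd (cr H g t))"
definition \<alpha> :: "nat \<Rightarrow> real" where "\<alpha> t = (r t \<bullet> (H *v r t)) / (norm (H *v p t))\<^sup>2"
definition \<gamma> :: "nat \<Rightarrow> real" where "\<gamma> t = (r (Suc t) \<bullet> (H *v r (Suc t))) / (r t \<bullet> (H *v r t))"

lemma cr_0: "s 0 = 0" "r 0 = - g" "p 0 = - g"
  by (simp_all add: cr_iterate_def cr_residual_def p_def)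

lemma cr_Suc:
  "s (Suc t) = s t + \<alpha> t *\<^sub>R p t"
  "r (Suc t) = r t - \<alpha> t *\<^sub>R (H *v p t)"
  "p (Suc t) = r (Suc t) + \<gamma> t *\<^sub>R p t"
  by (simp_all add: cr_iterate_def cr_residual_def p_def \<alpha>_def \<gamma>_def Let_def split: prod.splits)

lemma \<alpha>_nonneg: "\<alpha> t \<ge> 0" and \<gamma>_nonneg: "\<gamma> t \<ge> 0"
  by (simp_all add: \<alpha>_def \<gamma>_def nonneg)

lemma residual_eq: "r t = - g - H *v s t"
  by (induction t) (simp_all add: cr_0 cr_Suc algebra_simps matrix_vector_right_distrib
      matrix_vector_mult_scaleR)

text \<open>If \<open>p t\<close> were nonzero, \<open>\<alpha> t = 0\<close> would mean
  \<open>r t = 0\<close>, so the preceding \<open>\<gamma>\<close>, and with it \<open>p t\<close>,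
  would vanish; for \<open>t = 0\<close>, \<open>p\<close> and \<open>r\<close> coincide. Steps
  after exact convergence thus become trivial cases.\<close>

lemma p_eq_0: "\<alpha> t = 0 \<Longrightarrow> p t = 0"
proof (rule ccontr)
  assume "\<alpha> t = 0" "p t \<noteq> 0"
  then have "r t \<bullet> (H *v r t) = 0"
    by (auto simp: \<alpha>_def mult_eq_0_iff)
  then have "r t = 0" using pos by force
  then show False
  proof (cases t)
    case (Suc m)
    then have "p t = \<gamma> m *\<^sub>R p m" "\<gamma> m = 0"
      using cr_Suc(3)[of m] \<open>r t = 0\<close> by (auto simp: \<gamma>_def)
    then show False using \<open>p t \<noteq> 0\<close> by simp
  qed (use cr_0 \<open>p t \<noteq> 0\<close> in auto)
qed

text \<open>One strong induction, since each relation uses the others at smaller indices. The third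
  one makes \<open>\<alpha> t\<close> the step along \<open>p t\<close> that minimizes the next
  residual norm, which gives the first one at the next index for \<open>j = t\<close>.\<close>

lemma orthogonality:
  "(\<forall>j<t. r t \<bullet> (H *v p j) = 0) \<and> (\<forall>j<t. (H *v p t) \<bullet> (H *v p j) = 0) \<and>
   r t \<bullet> (H *v p t) = r t \<bullet> (H *v r t)"
proof (induction t rule: less_induct)
  case (less t)
  show ?case
  proof (cases t)
    case 0
    then show ?thesis by (simp add: cr_0)
  next
    case (Suc n)
    have IH: "r i \<bullet> (H *v p j) = 0" "(H *v p i) \<bullet> (H *v p j) = 0" if "j < i" "i \<le> n" for i j
      using less.IH[of i] that Suc by auto
    have rp: "r i \<bullet> (H *v p i) = r i \<bullet> (H *v r i)" if "i \<le> n" for i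
      using less.IH[of i] that Suc by auto
    have r_p: "r (Suc n) \<bullet> (H *v p j) = 0" if "j < Suc n" for j
    proof (cases "j = n")
      case True
      have "\<alpha> n * ((H *v p n) \<bullet> (H *v p n)) = r n \<bullet> (H *v p n)"
        using p_eq_0[of n] by (cases "p n = 0") (auto simp: rp \<alpha>_def mult_eq_0_iff power2_norm_eq_inner)
      then show ?thesis
        using True by (simp add: cr_Suc inner_diff_left)
    next
      case False
      then show ?thesis
        using that IH by (simp add: cr_Suc inner_diff_left)
    qed
    have r_r: "r (Suc n) \<bullet> (H *v r j) = 0" if "j < Suc n" for j
    proof (cases j)
      case 0
      then show ?thesis using r_p[of 0] by (simp add: cr_0)
    next
      case (Suc m)
      have "r j = p j - \<gamma> m *\<^sub>R p m"
        using Suc by (simp add: cr_Suc)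
      then show ?thesis
        using Suc that r_p[of j] r_p[of m]
        by (simp add: matrix_vector_mult_diff_distrib matrix_vector_mult_scaleR inner_diff_right)
    qed
    \<comment> \<open>\<open>\<alpha> j *\<^sub>R (H *v p j)\<close> is a difference of consecutive
      residuals, so these products reduce to the conjugacy in \<open>r_r\<close>.\<close>
    have \<alpha>Hr: "\<alpha> j * ((H *v r (Suc n)) \<bullet> (H *v p j)) = r (Suc n) \<bullet> (H *v r j) - r (Suc n) \<bullet> (H *v r (Suc j))" for j
    proof -
      have "\<alpha> j *\<^sub>R (H *v p j) = r j - r (Suc j)"
        by (simp add: cr_Suc)
      then have "(H *v r (Suc n)) \<bullet> (\<alpha> j *\<^sub>R (H *v p j)) = (H *v r (Suc n)) \<bullet> (r j - r (Suc j))"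
        by simp
      then show ?thesis
        by (simp add: symmetric inner_diff_right)
    qed
    have p_p: "(H *v p (Suc n)) \<bullet> (H *v p j) = 0" if "j < Suc n" for j
    proof (cases "\<alpha> j = 0")
      case True
      then show ?thesis using p_eq_0[of j] by simp
    next
      case False
      have expand: "(H *v p (Suc n)) \<bullet> (H *v p j)
          = (H *v r (Suc n)) \<bullet> (H *v p j) + \<gamma> n * ((H *v p n) \<bullet> (H *v p j))"
        by (simp add: cr_Suc(3) matrix_vector_right_distrib matrix_vector_mult_scaleR inner_add_left)
      show ?thesis
      proof (cases "j = n")
        case True
        have nz: "p n \<noteq> 0"
          using False True by (auto simp: \<alpha>_def)
        have rn: "r n \<bullet> (H *v r n) \<noteq> 0"
          using False True by (auto simp: \<alpha>_def)
        have "\<alpha> n * ((H *v p n) \<bullet> (H *v p n)) = r n \<bullet> (H *v r n)"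
          using nz by (simp add: \<alpha>_def mult_eq_0_iff power2_norm_eq_inner)
        \<comment> \<open>The choice of \<open>\<gamma> n\<close> cancels the product
          \<open>r (Suc n) \<bullet> (H *v r (Suc n))\<close> that \<open>\<alpha>Hr\<close> leaves
          for \<open>j = n\<close>.\<close>
        then have "\<gamma> n * (\<alpha> n * ((H *v p n) \<bullet> (H *v p n))) = r (Suc n) \<bullet> (H *v r (Suc n))"
          using rn by (simp add: \<gamma>_def)
        then have "\<alpha> n * ((H *v p (Suc n)) \<bullet> (H *v p n)) = 0"
          using expand \<alpha>Hr[of n] r_r[of n] True by (simp add: algebra_simps)
        then show ?thesis using False True by simp
      next
        case j: False
        then have "\<alpha> j * ((H *v r (Suc n)) \<bullet> (H *v p j)) = 0"
          using \<alpha>Hr[of j] r_r[of j] r_r[of "Suc j"] that by simp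
        then show ?thesis
          using expand False IH(2)[of j n] that j by simp
      qed
    qed
    have "r (Suc n) \<bullet> (H *v p (Suc n)) = r (Suc n) \<bullet> (H *v r (Suc n))"
      using r_p[of n] by (simp add: cr_Suc(3) matrix_vector_right_distrib
          matrix_vector_mult_scaleR inner_add_right)
    then show ?thesis
      using r_p p_p Suc by auto
  qed
qed

lemma residual_orthogonal: "j < t \<Longrightarrow> r t \<bullet> (H *v p j) = 0"
  using orthogonality by blast

lemma residual_conjugate:
  assumes "j < t"
  shows "r t \<bullet> (H *v r j) = 0"
proof (cases j)
  case 0
  then show ?thesis using residual_orthogonal[of 0 t] assms by (simp add: cr_0)
next
  case (Suc m)
  then have "r j = p j - \<gamma> m *\<^sub>R p m" by (simp add: cr_Suc)
  then show ?thesis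
    using Suc assms residual_orthogonal[of j t] residual_orthogonal[of m t]
    by (simp add: matrix_vector_mult_diff_distrib matrix_vector_mult_scaleR inner_diff_right)
qed

text \<open>With the directions as generators, orthogonality is immediate. That the spans contain
  the powers of \<open>H\<close> applied to \<open>g\<close> follows from \<open>p 0 = - g\<close>
  and \<open>mult_krylov\<close>.\<close>

definition krylov :: "nat \<Rightarrow> (real ^ 'n) set" where "krylov n = span (p ` {..<n})"

lemma krylov_mono: "m \<le> n \<Longrightarrow> krylov m \<subseteq> krylov n"
  unfolding krylov_def by (intro span_mono image_mono) auto

lemma p_in_krylov: "i < n \<Longrightarrow> p i \<in> krylov n"
  unfolding krylov_def by (intro span_base) auto

lemma subspace_krylov: "subspace (krylov n)"
  unfolding krylov_def by (rule subspace_span)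

lemma residual_in_krylov: "r n \<in> krylov (Suc n)"
proof (cases n)
  case 0
  then show ?thesis using p_in_krylov[of 0 1] by (simp add: cr_0)
next
  case (Suc m)
  then have "r n = p n - \<gamma> m *\<^sub>R p m" by (simp add: cr_Suc)
  then show ?thesis
    using p_in_krylov[of n "Suc n"] p_in_krylov[of m "Suc n"] Suc subspace_krylov
    by (simp add: subspace_diff subspace_scale)
qed

text \<open>\<open>H *v p i\<close> is a multiple of \<open>r i - r (Suc i)\<close> if
  \<open>\<alpha> i\<close> is nonzero; otherwise \<open>p i = 0\<close>.\<close>

lemma mult_krylov:
  assumes "v \<in> krylov n"
  shows "H *v v \<in> krylov (Suc n)"
proof -
  have "H *v p i \<in> krylov (Suc n)" if "i < n" for i
  proof (cases "\<alpha> i = 0")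
    case True
    then show ?thesis by (simp add: p_eq_0 krylov_def span_zero)
  next
    case False
    have "\<alpha> i *\<^sub>R (H *v p i) = r i - r (Suc i)"
      by (simp add: cr_Suc)
    then have "H *v p i = (1 / \<alpha> i) *\<^sub>R (r i - r (Suc i))"
      using False by (simp flip: \<open>\<alpha> i *\<^sub>R (H *v p i) = r i - r (Suc i)\<close>)
    moreover have "r i \<in> krylov (Suc n)" "r (Suc i) \<in> krylov (Suc n)"
      using residual_in_krylov[of i] residual_in_krylov[of "Suc i"] that
        krylov_mono[of "Suc i" "Suc n"] krylov_mono[of "Suc (Suc i)" "Suc n"] by auto
    ultimately show ?thesis
      by (simp add: krylov_def span_diff span_scale)
  qed
  then have "(*v) H ` span (p ` {..<n}) \<subseteq> krylov (Suc n)"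
    unfolding linear_span_image[OF matrix_vector_mul_linear, symmetric]
    by (intro span_minimal) (auto simp: subspace_krylov)
  then show ?thesis using assms by (auto simp: krylov_def)
qed

lemma residual_orthogonal_krylov:
  assumes "v \<in> krylov n"
  shows "r n \<bullet> (H *v v) = 0"
  using assms unfolding krylov_def
proof (induction rule: span_induct)
  case (step x)
  then show ?case using residual_orthogonal by auto
next
  case base
  show ?case
    by (auto simp: subspace_def matrix_vector_right_distrib matrix_vector_mult_scaleR inner_add_right)
qed

lemma iterate_in_krylov: "s n \<in> krylov n"
proof (induction n)
  case (Suc n)
  then have "s n \<in> krylov (Suc n)" using krylov_mono[of n "Suc n"] by auto
  then show ?case
    using p_in_krylov[of n "Suc n"] subspace_krylov
    by (simp add: cr_Suc(1) subspace_add subspace_scale)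
qed (simp add: cr_0 subspace_0 subspace_krylov)

text \<open>A competing residual differs from \<open>r n\<close> by \<open>H\<close> applied to a
  Krylov vector, which is orthogonal to \<open>r n\<close>.\<close>

lemma residual_minimal:
  assumes "v \<in> krylov n"
  shows "norm (r n) \<le> norm (- g - H *v v)"
proof -
  have "s n - v \<in> krylov n"
    using assms iterate_in_krylov by (simp add: krylov_def span_diff)
  then have "r n \<bullet> (H *v (s n - v)) = 0"
    by (rule residual_orthogonal_krylov)
  moreover have "- g - H *v v = r n + H *v (s n - v)"
    by (simp add: residual_eq matrix_vector_mult_diff_distrib)
  ultimately have "(norm (- g - H *v v))\<^sup>2 = (norm (r n))\<^sup>2 + (norm (H *v (s n - v)))\<^sup>2"
    by (simp add: norm_add_Pythagorean orthogonal_def)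
  then have "(norm (r n))\<^sup>2 \<le> (norm (- g - H *v v))\<^sup>2" by simp
  then show ?thesis by (rule power2_le_imp_le) simp
qed

text \<open>Pythagoras for \<open>- g = r n + H *v s n\<close> gives
  \<open>norm (H *v s n) \<le> norm g\<close>, and coercivity gives
  \<open>\<mu> * norm (s n) \<le> norm (H *v s n)\<close>.\<close>

lemma norm_iterate_le: "norm (s n) \<le> norm g / \<mu>"
proof -
  have "r n \<bullet> (H *v s n) = 0"
    by (rule residual_orthogonal_krylov[OF iterate_in_krylov])
  moreover have "- g = r n + H *v s n"
    by (simp add: residual_eq)
  ultimately have "(norm (- g))\<^sup>2 = (norm (r n))\<^sup>2 + (norm (H *v s n))\<^sup>2"
    by (simp add: norm_add_Pythagorean orthogonal_def)
  then have "(norm (H *v s n))\<^sup>2 \<le> (norm g)\<^sup>2" by simp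
  then have "norm (H *v s n) \<le> norm g" by (rule power2_le_imp_le) simp
  moreover have "\<mu> * norm (s n) \<le> norm (H *v s n)"
  proof (cases "s n = 0")
    case False
    have "norm (s n) * (\<mu> * norm (s n)) \<le> s n \<bullet> (H *v s n)"
      using coercive[of "s n"] by (simp add: dot_square_norm power2_eq_square mult_ac)
    also have "\<dots> \<le> norm (s n) * norm (H *v s n)" by (rule norm_cauchy_schwarz)
    finally show ?thesis using False by simp
  qed simp
  ultimately show ?thesis
    using \<mu>_pos by (simp add: field_simps)
qed

subsection \<open>Convergence rate\<close>

text \<open>The vectors \<open>\<tau>\<close> and \<open>u\<close> are \<open>b\<^sup>n T\<^sub>n(B / b) g\<close> and \<open>b\<^sup>n\<^sup>-\<^sup>1 U\<^sub>n\<^sub>-\<^sub>1(B / b) g\<close> up to sign, where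
  \<open>B = (M + \<mu>) - 2 H\<close>, \<open>b = M - \<mu>\<close>, and \<open>T\<close> and \<open>U\<close> are the Chebyshev polynomials of the two
  kinds; \<open>c\<close> and \<open>d\<close> are the values of these polynomials at \<open>H = 0\<close>. The Pell equation
  \<open>T\<^sub>n\<^sup>2 + (1 - x\<^sup>2) U\<^sub>n\<^sub>-\<^sub>1\<^sup>2 = 1\<close>, read as an identity between operators, replaces the spectral
  theorem.\<close>

lemma chebyshev_krylov:
  "\<exists>\<tau> u y z c d. \<tau> = c *\<^sub>R (- g) - H *v y \<and> u = d *\<^sub>R (- g) - H *v z \<and>
     u \<in> krylov n \<and> y \<in> krylov n \<and> z \<in> krylov n \<and> \<tau> \<in> krylov (Suc n) \<and>
     c + 2 * sqrt (M * \<mu>) * d = (M + \<mu> + 2 * sqrt (M * \<mu>)) ^ n \<and>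
     c - 2 * sqrt (M * \<mu>) * d = (M + \<mu> - 2 * sqrt (M * \<mu>)) ^ n \<and>
     (norm \<tau>)\<^sup>2 + (M - \<mu>)\<^sup>2 * (norm u)\<^sup>2 - (norm (shifted u))\<^sup>2 = ((M - \<mu>) ^ n * norm g)\<^sup>2"
proof (induction n)
  case 0
  have "- g \<in> krylov (Suc 0)"
    using p_in_krylov[of 0 "Suc 0"] by (simp add: cr_0)
  then show ?case
    by (intro exI[of _ "- g"] exI[of _ 0] exI[of _ 1])
      (simp add: krylov_def span_zero shifted_def)
next
  case (Suc n)
  then obtain \<tau> u y z c d where
    \<tau>: "\<tau> = c *\<^sub>R (- g) - H *v y" and u: "u = d *\<^sub>R (- g) - H *v z" and
    K: "u \<in> krylov n" "y \<in> krylov n" "z \<in> krylov n" and \<tau>K: "\<tau> \<in> krylov (Suc n)" and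
    c1: "c + 2 * sqrt (M * \<mu>) * d = (M + \<mu> + 2 * sqrt (M * \<mu>)) ^ n" and
    c2: "c - 2 * sqrt (M * \<mu>) * d = (M + \<mu> - 2 * sqrt (M * \<mu>)) ^ n" and
    energy: "(norm \<tau>)\<^sup>2 + (M - \<mu>)\<^sup>2 * (norm u)\<^sup>2 - (norm (shifted u))\<^sup>2 = ((M - \<mu>) ^ n * norm g)\<^sup>2"
    by blast
  let ?a = "M + \<mu>" and ?b = "M - \<mu>" and ?e = "2 * sqrt (M * \<mu>)"
  \<comment> \<open>With \<open>x = B / b\<close>, cleared of denominators:
    \<open>T_(n+1) = x T_n + (x^2 - 1) U_(n-1)\<close> and
    \<open>U_n = x U_(n-1) + T_n\<close>.\<close>
  define \<tau>' where "\<tau>' = shifted \<tau> - ?b\<^sup>2 *\<^sub>R u + shifted (shifted u)"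
  define u' where "u' = shifted u + \<tau>"
  \<comment> \<open>Expanded with \<open>?a\<^sup>2 - ?b\<^sup>2 = 4 * M * \<mu>\<close>:
    \<open>y'\<close> and \<open>z'\<close> collect what carries a factor \<open>H\<close>, while
    \<open>c'\<close> and \<open>d'\<close> follow the same recursion at
    \<open>H = 0\<close>.\<close>
  define y' where "y' = ?a *\<^sub>R y + 2 *\<^sub>R \<tau> + (4 * M * \<mu>) *\<^sub>R z + (4 * ?a) *\<^sub>R u - 4 *\<^sub>R (H *v u)"
  define z' where "z' = ?a *\<^sub>R z + 2 *\<^sub>R u + y"
  define c' where "c' = ?a * c + 4 * M * \<mu> * d"
  define d' where "d' = ?a * d + c"
  have K': "u \<in> krylov (Suc n)" "y \<in> krylov (Suc n)" "z \<in> krylov (Suc n)"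
    using K krylov_mono[of n "Suc n"] by auto
  note mem = K' \<tau>K mult_krylov[OF K(1)]
  have "M * \<mu> \<ge> 0" using \<mu>_pos \<mu>_le_M by simp
  then have e2: "?e * ?e = 4 * M * \<mu>" by simp
  have "\<tau>' = c' *\<^sub>R (- g) - H *v y'"
  proof -
    have "\<tau>' = ?a *\<^sub>R \<tau> - 2 *\<^sub>R (H *v \<tau>) + (4 * M * \<mu>) *\<^sub>R u - (4 * ?a) *\<^sub>R (H *v u) + 4 *\<^sub>R (H *v (H *v u))"
      by (simp add: \<tau>'_def shifted_def matrix_vector_mult_diff_distrib matrix_vector_mult_scaleR
          vec_eq_iff algebra_simps power2_eq_square)
    also have "?a *\<^sub>R \<tau> = ?a *\<^sub>R (c *\<^sub>R (- g) - H *v y)" by (simp add: \<tau>)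
    also have "(4 * M * \<mu>) *\<^sub>R u = (4 * M * \<mu>) *\<^sub>R (d *\<^sub>R (- g) - H *v z)" by (simp add: u)
    finally show ?thesis
      by (simp add: c'_def y'_def matrix_vector_right_distrib matrix_vector_mult_diff_distrib
          matrix_vector_mult_scaleR vec_eq_iff algebra_simps)
  qed
  moreover have "u' = d' *\<^sub>R (- g) - H *v z'"
  proof -
    have "u' = ?a *\<^sub>R u - 2 *\<^sub>R (H *v u) + \<tau>" by (simp add: u'_def shifted_def)
    also have "?a *\<^sub>R u = ?a *\<^sub>R (d *\<^sub>R (- g) - H *v z)" by (simp add: u)
    also have "\<tau> = c *\<^sub>R (- g) - H *v y" by (rule \<tau>)
    finally show ?thesis
      by (simp add: d'_def z'_def matrix_vector_right_distrib matrix_vector_mult_scaleR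
          vec_eq_iff algebra_simps)
  qed
  moreover have u'K: "u' \<in> krylov (Suc n)" and "y' \<in> krylov (Suc n)" "z' \<in> krylov (Suc n)"
    using mem unfolding u'_def y'_def z'_def shifted_def krylov_def
    by (auto intro!: span_add span_diff span_scale)
  moreover have "\<tau>' \<in> krylov (Suc (Suc n))"
  proof -
    have *: "v \<in> krylov (Suc n) \<Longrightarrow> v \<in> krylov (Suc (Suc n))" for v
      using krylov_mono[of "Suc n" "Suc (Suc n)"] by auto
    have sh: "v \<in> krylov (Suc n) \<Longrightarrow> shifted v \<in> krylov (Suc (Suc n))" for v
      using *[of v] mult_krylov[of v "Suc n"] unfolding shifted_def krylov_def
      by (auto intro!: span_diff span_scale)
    have "shifted u \<in> krylov (Suc n)"
      using mem unfolding shifted_def krylov_def by (auto intro!: span_diff span_scale)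
    then show ?thesis
      using sh *[OF K'(1)] sh[OF \<tau>K] unfolding \<tau>'_def krylov_def
      by (auto intro!: span_add span_diff span_scale)
  qed
  moreover have "c' + ?e * d' = (?a + ?e) ^ Suc n"
  proof -
    have "c' + ?e * d' = ?a * c + ?e * ?e * d + ?e * (?a * d + c)"
      by (simp only: c'_def d'_def e2)
    also have "\<dots> = (?a + ?e) * (c + ?e * d)" by (simp add: algebra_simps)
    finally show ?thesis by (simp only: c1 power_Suc)
  qed
  moreover have "c' - ?e * d' = (?a - ?e) ^ Suc n"
  proof -
    have "c' - ?e * d' = ?a * c + ?e * ?e * d - ?e * (?a * d + c)"
      by (simp only: c'_def d'_def e2)
    also have "\<dots> = (?a - ?e) * (c - ?e * d)" by (simp add: algebra_simps)
    finally show ?thesis by (simp only: c2 power_Suc)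
  qed
  \<comment> \<open>The Pell form is multiplied by \<open>?b\<^sup>2\<close>; the cross terms cancel
    because \<open>shifted\<close> is symmetric.\<close>
  moreover have "(norm \<tau>')\<^sup>2 + ?b\<^sup>2 * (norm u')\<^sup>2 - (norm (shifted u'))\<^sup>2 = (?b ^ Suc n * norm g)\<^sup>2"
  proof -
    have "shifted \<tau> \<bullet> u = \<tau> \<bullet> shifted u" "shifted (shifted u) \<bullet> u = shifted u \<bullet> shifted u"
      by (simp_all add: shifted_symmetric)
    moreover have "shifted u' = shifted (shifted u) + shifted \<tau>"
      by (simp add: u'_def linear_add[OF linear_shifted])
    moreover have "(norm \<tau>')\<^sup>2 = (norm (shifted (shifted u) + shifted \<tau>))\<^sup>2 + ?b\<^sup>2 * ?b\<^sup>2 * (norm u)\<^sup>2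
        - 2 * ?b\<^sup>2 * (shifted \<tau> \<bullet> u + shifted (shifted u) \<bullet> u)"
      unfolding \<tau>'_def power2_norm_eq_inner
      by (simp only: inner_add_left inner_add_right inner_diff_left inner_diff_right
          inner_scaleR_left inner_scaleR_right)
        (simp add: inner_commute algebra_simps)
    moreover have "(norm u')\<^sup>2 = (norm (shifted u))\<^sup>2 + 2 * (\<tau> \<bullet> shifted u) + (norm \<tau>)\<^sup>2"
      unfolding u'_def power2_norm_eq_inner
      by (simp add: inner_add_left inner_add_right inner_commute)
    ultimately have "(norm \<tau>')\<^sup>2 + ?b\<^sup>2 * (norm u')\<^sup>2 - (norm (shifted u'))\<^sup>2
        = ?b\<^sup>2 * ((norm \<tau>)\<^sup>2 + ?b\<^sup>2 * (norm u)\<^sup>2 - (norm (shifted u))\<^sup>2)"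
      by (simp only: power2_norm_eq_inner[of "shifted u"]) (simp add: algebra_simps)
    then show ?thesis
      by (simp only: energy) (simp add: power_mult_distrib)
  qed
  ultimately show ?case by blast
qed

text \<open>\<open>\<tau>\<close> divided by \<open>c\<close> is the residual of a Krylov vector.
  The Pell identity gives \<open>norm \<tau> \<le> (M - \<mu>) ^ n * norm g\<close>, and
  \<open>2 * c\<close> is at least \<open>(sqrt M + sqrt \<mu>) ^ (2 * n)\<close>.\<close>

lemma residual_le_power:
  "norm (r n) \<le> 2 * ((sqrt M - sqrt \<mu>) / (sqrt M + sqrt \<mu>)) ^ n * norm g"
proof -
  obtain \<tau> u y z c d where
    \<tau>: "\<tau> = c *\<^sub>R (- g) - H *v y" and y: "y \<in> krylov n" and
    c1: "c + 2 * sqrt (M * \<mu>) * d = (M + \<mu> + 2 * sqrt (M * \<mu>)) ^ n" and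
    c2: "c - 2 * sqrt (M * \<mu>) * d = (M + \<mu> - 2 * sqrt (M * \<mu>)) ^ n" and
    energy: "(norm \<tau>)\<^sup>2 + (M - \<mu>)\<^sup>2 * (norm u)\<^sup>2 - (norm (shifted u))\<^sup>2 = ((M - \<mu>) ^ n * norm g)\<^sup>2"
    using chebyshev_krylov[of n] by blast
  have M: "M > 0" using \<mu>_pos \<mu>_le_M by simp
  let ?A = "sqrt M + sqrt \<mu>" and ?B = "sqrt M - sqrt \<mu>"
  have A: "?A > 0" and B: "?B \<ge> 0" using M \<mu>_pos \<mu>_le_M by (auto intro: add_pos_pos)
  have AA: "M + \<mu> + 2 * sqrt (M * \<mu>) = ?A * ?A" and BB: "M + \<mu> - 2 * sqrt (M * \<mu>) = ?B * ?B"
    and AB: "M - \<mu> = ?A * ?B"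
    using M \<mu>_pos by (simp_all add: algebra_simps real_sqrt_mult)
  have "2 * c = (?A * ?A) ^ n + (?B * ?B) ^ n"
    using c1 c2 unfolding AA BB by linarith
  then have c: "2 * c \<ge> ?A ^ n * ?A ^ n"
    using B by (simp add: power_mult_distrib)
  then have cpos: "c > 0"
    using A by (smt (verit) zero_less_power mult_pos_pos)
  have "(norm (shifted u))\<^sup>2 \<le> (M - \<mu>)\<^sup>2 * (norm u)\<^sup>2"
    using norm_shifted_le[of u] by (metis norm_ge_zero power_mono power_mult_distrib)
  then have "(norm \<tau>)\<^sup>2 \<le> ((M - \<mu>) ^ n * norm g)\<^sup>2"
    using energy by linarith
  then have norm_\<tau>: "norm \<tau> \<le> (M - \<mu>) ^ n * norm g"
    by (rule power2_le_imp_le) (use \<mu>_le_M in simp)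
  have "norm (r n) \<le> norm (- g - H *v ((1 / c) *\<^sub>R y))"
    using y by (intro residual_minimal) (simp add: krylov_def span_scale)
  also have "- g - H *v ((1 / c) *\<^sub>R y) = (1 / c) *\<^sub>R \<tau>"
    using cpos by (simp add: \<tau> matrix_vector_mult_scaleR scaleR_diff_right)
  also have "norm ((1 / c) *\<^sub>R \<tau>) = norm \<tau> / c"
    using cpos by simp
  finally have "c * norm (r n) \<le> (?A * ?B) ^ n * norm g"
    using norm_\<tau> cpos AB by (simp add: field_simps)
  moreover have "?A ^ n * ?A ^ n * norm (r n) \<le> 2 * c * norm (r n)"
    using c by (intro mult_right_mono) auto
  ultimately have "?A ^ n * (?A ^ n * norm (r n)) \<le> ?A ^ n * (2 * ?B ^ n * norm g)"
    by (simp add: power_mult_distrib mult_ac)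
  then have "?A ^ n * norm (r n) \<le> 2 * ?B ^ n * norm g"
    using A by (subst (asm) mult_le_cancel_left_pos) auto
  then show ?thesis
    using A by (simp add: power_divide field_simps)
qed

text \<open>The recursion is total and may be followed beyond the steps of the solver; the limit
  decides the signs in \<open>residual_inner_p_nonneg\<close>.\<close>

lemma residual_tendsto_0: "r \<longlonglongrightarrow> 0"
proof (rule Lim_null_comparison)
  show "\<forall>\<^sub>F n in sequentially. norm (r n) \<le> 2 * ((sqrt M - sqrt \<mu>) / (sqrt M + sqrt \<mu>)) ^ n * norm g"
    using residual_le_power by simp
  have "0 \<le> sqrt M - sqrt \<mu>" "0 < sqrt \<mu>" using \<mu>_pos \<mu>_le_M by auto
  then have "\<bar>sqrt M - sqrt \<mu>\<bar> < \<bar>sqrt M + sqrt \<mu>\<bar>"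
    by linarith
  then have "norm ((sqrt M - sqrt \<mu>) / (sqrt M + sqrt \<mu>)) < 1"
    by (simp add: abs_divide)
  then show "(\<lambda>n. 2 * ((sqrt M - sqrt \<mu>) / (sqrt M + sqrt \<mu>)) ^ n * norm g) \<longlonglongrightarrow> 0"
    by (intro tendsto_mult_left_zero tendsto_mult_right_zero LIMSEQ_power_zero)
qed

lemma residual_le_exp:
  "norm (r n) \<le> 2 * exp (- (2 * real n / sqrt (M / \<mu>))) * norm g"
proof -
  have M: "M > 0" using \<mu>_pos \<mu>_le_M by simp
  define w where "w = sqrt \<mu> / sqrt M"
  have w: "0 < w" "w \<le> 1" using M \<mu>_pos \<mu>_le_M by (auto simp: w_def)
  have "1 - w \<le> exp (- (2 * w)) * (1 + w)"
  proof -
    \<comment> \<open>\<open>F 0 = 0\<close> and \<open>F\<close> increases;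
      \<open>F w \<ge> 0\<close> is the wanted inequality multiplied by
      \<open>exp w\<close>.\<close>
    define F where "F t = (1 + t) * exp (- t) - (1 - t) * exp t" for t :: real
    have "F 0 \<le> F w"
    proof (rule DERIV_nonneg_imp_nondecreasing[of 0 w F])
      fix t :: real assume t: "0 \<le> t" "t \<le> w"
      show "\<exists>y. (F has_real_derivative y) (at t) \<and> 0 \<le> y"
      proof (intro exI[of _ "t * (exp t - exp (- t))"] conjI)
        show "(F has_real_derivative t * (exp t - exp (- t))) (at t)"
          unfolding F_def by (auto intro!: derivative_eq_intros simp: algebra_simps)
        show "0 \<le> t * (exp t - exp (- t))" using t by simp
      qed
    qed (use w in simp)
    then have "exp (- w) * ((1 - w) * exp w) \<le> exp (- w) * ((1 + w) * exp (- w))"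
      by (simp add: F_def)
    moreover have "exp (- w) * ((1 - w) * exp w) = 1 - w"
      by (simp add: exp_minus field_simps)
    moreover have "exp (- w) * ((1 + w) * exp (- w)) = exp (- (2 * w)) * (1 + w)"
      by (simp add: mult_ac flip: exp_add)
    ultimately show ?thesis by simp
  qed
  moreover have "(sqrt M - sqrt \<mu>) / (sqrt M + sqrt \<mu>) = (1 - w) / (1 + w)"
  proof -
    have "sqrt M - sqrt \<mu> = sqrt M * (1 - w)" "sqrt M + sqrt \<mu> = sqrt M * (1 + w)"
      using M by (simp_all add: w_def algebra_simps)
    then show ?thesis using M by simp
  qed
  ultimately have "(sqrt M - sqrt \<mu>) / (sqrt M + sqrt \<mu>) \<le> exp (- (2 * w))"
    using w by (simp add: pos_divide_le_eq)
  moreover have "0 \<le> (sqrt M - sqrt \<mu>) / (sqrt M + sqrt \<mu>)"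
    using M \<mu>_pos \<mu>_le_M by simp
  ultimately have "((sqrt M - sqrt \<mu>) / (sqrt M + sqrt \<mu>)) ^ n \<le> exp (- (2 * w)) ^ n"
    by (rule power_mono)
  also have "\<dots> = exp (- (2 * real n / sqrt (M / \<mu>)))"
    by (simp add: w_def real_sqrt_divide flip: exp_of_nat_mult)
  finally have "2 * ((sqrt M - sqrt \<mu>) / (sqrt M + sqrt \<mu>)) ^ n * norm g
      \<le> 2 * exp (- (2 * real n / sqrt (M / \<mu>))) * norm g"
    by (intro mult_right_mono mult_left_mono) auto
  then show ?thesis using residual_le_power[of n] by simp
qed

subsection \<open>Descent\<close>

text \<open>\<open>p i\<close> is a combination of residuals with nonnegative coefficients, and
  residuals are pairwise conjugate, so only a nonnegative diagonal term can survive.\<close>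

lemma p_residual_nonneg: "p i \<bullet> (H *v r j) \<ge> 0"
proof (induction i)
  case 0
  have "p 0 \<bullet> (H *v r j) = r j \<bullet> (H *v p 0)"
    by (metis inner_commute symmetric)
  then show ?case
    using residual_orthogonal[of 0 j] nonneg[of "- g"]
    by (cases j) (simp_all add: cr_0)
next
  case (Suc i)
  have "r (Suc i) \<bullet> (H *v r j) \<ge> 0"
  proof (cases "j = Suc i")
    case False
    show ?thesis
      using False residual_conjugate[of j "Suc i"] residual_conjugate[of "Suc i" j] symmetric[of "r (Suc i)" "r j"]
      by (cases j "Suc i" rule: linorder_cases) (simp_all add: inner_commute)
  qed (simp add: nonneg)
  then show ?case
    using Suc \<gamma>_nonneg[of i] by (simp add: cr_Suc(3) inner_add_left)
qed

text \<open>This makes \<open>r j \<bullet> p i\<close> decrease in \<open>j\<close>: a step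
  subtracts \<open>\<alpha> j\<close> times this product.\<close>

lemma p_conjugate_nonneg: "p i \<bullet> (H *v p j) \<ge> 0"
proof (induction j)
  case 0
  show ?case using p_residual_nonneg[of i 0] by (simp add: cr_0)
next
  case (Suc j)
  then show ?case
    using p_residual_nonneg[of i "Suc j"] \<gamma>_nonneg[of j]
    by (simp add: cr_Suc(3) matrix_vector_right_distrib matrix_vector_mult_scaleR inner_add_right)
qed

text \<open>\<open>r t \<bullet> p i\<close> decreases in \<open>t\<close>, and its limit is \<open>0\<close>.\<close>

lemma residual_inner_p_nonneg: "r t \<bullet> p i \<ge> 0"
proof -
  have "decseq (\<lambda>t. r t \<bullet> p i)"
    using p_conjugate_nonneg \<alpha>_nonneg
    by (intro decseq_SucI) (simp add: cr_Suc inner_diff_left inner_diff_right inner_commute[of _ "p i"])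
  moreover have "(\<lambda>t. r t \<bullet> p i) \<longlonglongrightarrow> 0"
    using tendsto_inner[OF residual_tendsto_0 tendsto_const] by simp
  ultimately show ?thesis by (rule decseq_ge)
qed

lemma residual_inner_iterate_nonneg: "r t \<bullet> s n \<ge> 0"
  by (induction n) (simp_all add: cr_0 cr_Suc inner_add_right residual_inner_p_nonneg \<alpha>_nonneg)

text \<open>By \<open>residual_eq\<close> this is \<open>r n \<bullet> s n \<ge> 0\<close>. It is
  the curvature hypothesis of \<open>inexact_newton_sufficient\<close>.\<close>

lemma iterate_curvature_le: "s n \<bullet> (H *v s n) \<le> - (g \<bullet> s n)"
  using residual_inner_iterate_nonneg[of n n]
  by (simp add: residual_eq inner_diff_left symmetric)

end

section \<open>One outer iteration\<close>

text \<open>\<open>INS\<close> returns the index \<open>T\<close>; \<open>SUF\<close> steps back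
  from some \<open>t > T\<close>; \<open>TER\<close> has met the tolerance or reached
  \<open>Tmax \<ge> T\<close>.\<close>

lemma inner_loop_iterate:
  assumes "T \<le> Tmax"
  shows "\<exists>n. fst (inner_loop f \<rho> T Tmax \<omega> x H t) = cr_iterate H (grad f x) n \<and>
    (T \<le> n \<or> norm (cr_residual H (grad f x) n) \<le> \<omega> * norm (grad f x))"
  using assms
proof (induction f \<rho> T Tmax \<omega> x H t rule: inner_loop.induct)
  case (1 f \<rho> T Tmax \<omega> x H t)
  let ?g = "grad f x"
  consider "T \<le> t" "\<not> sufficient f x (sufficiency_const \<rho> H ?g t) (cr_iterate H ?g t)"
    | "\<not> (T \<le> t \<and> \<not> sufficient f x (sufficiency_const \<rho> H ?g t) (cr_iterate H ?g t))"
      "norm (cr_residual H ?g t) \<le> \<omega> * norm ?g \<or> Tmax \<le> t"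
    | "\<not> (T \<le> t \<and> \<not> sufficient f x (sufficiency_const \<rho> H ?g t) (cr_iterate H ?g t))"
      "\<not> (norm (cr_residual H ?g t) \<le> \<omega> * norm ?g \<or> Tmax \<le> t)"
    by blast
  then show ?case
  proof cases
    case 1
    then show ?thesis
      by (cases "t = T"; subst inner_loop.simps)
        (auto simp: Let_def intro: exI[of _ t] exI[of _ "t - 1"])
  next
    case 2
    then have "fst (inner_loop f \<rho> T Tmax \<omega> x H t) = cr_iterate H ?g t"
      by (subst inner_loop.simps) (auto simp: Let_def)
    then show ?thesis
      using 2 "1.prems" by (intro exI[of _ t]) auto
  next
    case 3
    then have "inner_loop f \<rho> T Tmax \<omega> x H t = inner_loop f \<rho> T Tmax \<omega> x H (t + 1)"
      by (subst inner_loop.simps) (auto simp: Let_def)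
    then show ?thesis
      using "1.IH"[OF refl 3 "1.prems"] by simp
  qed
qed

lemma backtrack_eq:
  assumes "sufficient f x \<rho> s"
  shows "backtrack f \<rho> \<zeta> x s = s"
proof -
  have "(LEAST j. sufficient f x \<rho> (\<zeta> ^ j *\<^sub>R s)) = 0"
    using assms by (intro Least_eq_0) simp
  then show ?thesis by (simp add: backtrack_def)
qed

section \<open>Inexact Newton steps\<close>

context hessian_lipschitz
begin

text \<open>The bound on \<open>norm s\<close> keeps the cubic remainder below
  \<open>1 / 2 - c\<close> times the curvature. The change of \<open>f\<close> is then at most
  \<open>grad f x \<bullet> s\<close> plus \<open>1 - c\<close> times the curvature, which is at
  most \<open>- (grad f x \<bullet> s)\<close>.\<close>

lemma inexact_newton_sufficient:
  assumes sc: "strongly_convex \<mu> f" and L: "L > 0" and c: "c \<le> 1 / 2"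
    and s: "norm s \<le> 3 * (1 - 2 * c) * \<mu> / L"
    and curvature: "s \<bullet> (hessian f x *v s) \<le> - (grad f x \<bullet> s)"
  shows "sufficient f x c s"
proof -
  let ?q = "s \<bullet> (hessian f x *v s)"
  have "L / 6 * norm s ^ 3 = L / 6 * (norm s)\<^sup>2 * norm s"
    by (simp add: power2_eq_square power3_eq_cube)
  also have "\<dots> \<le> L / 6 * (norm s)\<^sup>2 * (3 * (1 - 2 * c) * \<mu> / L)"
    using L by (intro mult_left_mono[OF s]) simp
  also have "\<dots> = (1 / 2 - c) * (\<mu> * (s \<bullet> s))"
    using L by (simp add: power2_norm_eq_inner field_simps)
  also have "\<dots> \<le> (1 / 2 - c) * ?q"
    using c by (intro mult_left_mono hessian_coercive[OF sc]) simp
  finally have "L / 6 * norm s ^ 3 \<le> (1 / 2 - c) * ?q" .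
  moreover have "f (x + s) \<le> f x + grad f x \<bullet> s + ?q / 2 + L / 6 * norm s ^ 3"
    using abs_le_D1[OF taylor[of x s]] by linarith
  moreover have "(1 - c) * ?q \<le> (1 - c) * - (grad f x \<bullet> s)"
    using c by (intro mult_left_mono curvature) simp
  ultimately show ?thesis
    unfolding sufficient_def by (simp add: algebra_simps)
qed

text \<open>The new gradient is the Taylor error of the gradient minus the residual; each
  contributes half of the bound.\<close>

lemma inexact_newton_grad:
  assumes "\<mu> > 0" "L \<ge> 0" and s: "norm s \<le> norm (grad f x) / \<mu>"
    and residual: "norm (- grad f x - hessian f x *v s) \<le> L / (2 * \<mu>\<^sup>2) * (norm (grad f x))\<^sup>2"
  shows "norm (grad f (x + s)) \<le> L / \<mu>\<^sup>2 * (norm (grad f x))\<^sup>2"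
proof -
  have "norm (grad f (x + s)) \<le> norm (grad f (x + s) - grad f x - hessian f x *v s)
      + norm (- grad f x - hessian f x *v s)"
    using norm_triangle_ineq4[of "grad f (x + s) - grad f x - hessian f x *v s"
        "- grad f x - hessian f x *v s"] by simp
  also have "\<dots> \<le> L / 2 * (norm s)\<^sup>2 + L / (2 * \<mu>\<^sup>2) * (norm (grad f x))\<^sup>2"
    by (intro add_mono grad_taylor residual)
  also have "L / 2 * (norm s)\<^sup>2 \<le> L / 2 * (norm (grad f x) / \<mu>)\<^sup>2"
    using s assms(2) by (intro mult_left_mono power_mono) auto
  also have "L / 2 * (norm (grad f x) / \<mu>)\<^sup>2 + L / (2 * \<mu>\<^sup>2) * (norm (grad f x))\<^sup>2
      = L / \<mu>\<^sup>2 * (norm (grad f x))\<^sup>2"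
    using assms(1) by (simp add: power_divide field_simps)
  finally show ?thesis by simp
qed

text \<open>The first conclusion makes backtracking accept the full step; the last keeps the
  iterates in the sublevel set where \<open>H\<^sub>0\<close> bounds the Hessian.\<close>

lemma inner_solver_step:
  fixes T Tmax :: nat and \<rho> \<omega> M :: real and x :: "real ^ 'n"
  defines "s \<equiv> fst (inner_solver f \<rho> T Tmax \<omega> x (hessian f x))"
  assumes sc: "strongly_convex \<mu> f" and \<mu>: "\<mu> > 0" and L: "L > 0"
    and \<rho>: "0 \<le> \<rho>" "\<rho> \<le> 1 / 2" and g0: "grad f x \<noteq> 0"
    and g: "norm (grad f x) \<le> 3 * (1 - 2 * \<rho>) * \<mu>\<^sup>2 / L"
    and M: "spectral_norm (hessian f x) \<le> M"
    and T: "T \<le> Tmax" "sqrt (M / \<mu>) / 2 * ln (4 * \<mu>\<^sup>2 / (norm (grad f x) * L)) \<le> real T"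
    and \<omega>: "\<omega> \<le> norm (grad f x) * L / (2 * \<mu>\<^sup>2)"
  shows "sufficient f x \<rho> s" and "norm (grad f (x + s)) \<le> L / \<mu>\<^sup>2 * (norm (grad f x))\<^sup>2"
    and "f (x + s) \<le> f x"
proof -
  let ?g = "grad f x" and ?H = "hessian f x"
  interpret cr_run ?H \<mu> M ?g
  proof
    show "(?H *v u) \<bullet> v = u \<bullet> (?H *v v)" for u v by (rule hessian_symmetric)
    show "\<mu> * (v \<bullet> v) \<le> v \<bullet> (?H *v v)" for v by (rule hessian_coercive[OF sc])
    show "v \<bullet> (?H *v v) \<le> M * (v \<bullet> v)" for v
    proof -
      have "v \<bullet> (?H *v v) \<le> norm v * (spectral_norm ?H * norm v)"
        by (intro order_trans[OF norm_cauchy_schwarz] mult_left_mono norm_matrix_vector_le) simp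
      also have "\<dots> \<le> norm v * (M * norm v)"
        by (intro mult_left_mono mult_right_mono M) auto
      finally show ?thesis by (simp add: dot_square_norm power2_eq_square mult_ac)
    qed
  qed (rule \<mu>)
  obtain n where s: "s = cr_iterate ?H ?g n"
    and n: "T \<le> n \<or> norm (cr_residual ?H ?g n) \<le> \<omega> * norm ?g"
    using inner_loop_iterate[OF T(1)] unfolding s_def inner_solver_def by blast
  have s_le: "norm s \<le> norm ?g / \<mu>"
    unfolding s by (rule norm_iterate_le)
  also have "\<dots> \<le> 3 * (1 - 2 * \<rho>) * \<mu>\<^sup>2 / L / \<mu>"
    using \<mu> by (intro divide_right_mono g) simp
  also have "\<dots> = 3 * (1 - 2 * \<rho>) * \<mu> / L"
    using \<mu> by (simp add: power2_eq_square)
  finally have "norm s \<le> 3 * (1 - 2 * \<rho>) * \<mu> / L" .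
  then show suff: "sufficient f x \<rho> s"
    using iterate_curvature_le[of n] by (intro inexact_newton_sufficient[OF sc L \<rho>(2)]) (simp_all add: s)
  have "norm (cr_residual ?H ?g n) \<le> norm ?g * L / (2 * \<mu>\<^sup>2) * norm ?g"
    using n
  proof
    \<comment> \<open>The logarithm in the bound on \<open>T\<close> brings the exponential down to
      \<open>norm ?g * L / (4 * \<mu>\<^sup>2)\<close>; with the factor \<open>2\<close> of
      \<open>residual_le_exp\<close> this matches the bound on \<open>\<omega>\<close>.\<close>
    assume "T \<le> n"
    have pos: "0 < 4 * \<mu>\<^sup>2 / (norm ?g * L)" using \<mu> L g0 by simp
    have "0 < sqrt (M / \<mu>)" using \<mu> \<mu>_le_M by simp
    moreover have "sqrt (M / \<mu>) / 2 * ln (4 * \<mu>\<^sup>2 / (norm ?g * L)) \<le> real n"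
      using T(2) \<open>T \<le> n\<close> by linarith
    ultimately have "ln (4 * \<mu>\<^sup>2 / (norm ?g * L)) \<le> 2 * real n / sqrt (M / \<mu>)"
      by (simp add: field_simps)
    then have "exp (- (2 * real n / sqrt (M / \<mu>))) \<le> exp (- ln (4 * \<mu>\<^sup>2 / (norm ?g * L)))"
      by simp
    also have "\<dots> = norm ?g * L / (4 * \<mu>\<^sup>2)"
      unfolding exp_minus exp_ln[OF pos] by simp
    finally have "2 * exp (- (2 * real n / sqrt (M / \<mu>))) * norm ?g \<le> 2 * (norm ?g * L / (4 * \<mu>\<^sup>2)) * norm ?g"
      by (intro mult_right_mono mult_left_mono) auto
    also have "\<dots> = norm ?g * L / (2 * \<mu>\<^sup>2) * norm ?g" by simp
    finally show ?thesis using residual_le_exp[of n] by (rule order_trans[rotated])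
  next
    assume "norm (cr_residual ?H ?g n) \<le> \<omega> * norm ?g"
    also have "\<dots> \<le> norm ?g * L / (2 * \<mu>\<^sup>2) * norm ?g"
      by (intro mult_right_mono \<omega>) simp
    finally show ?thesis .
  qed
  then have "norm (- ?g - ?H *v s) \<le> L / (2 * \<mu>\<^sup>2) * (norm ?g)\<^sup>2"
    by (simp add: s residual_eq power2_eq_square mult_ac)
  then show "norm (grad f (x + s)) \<le> L / \<mu>\<^sup>2 * (norm ?g)\<^sup>2"
    using L by (intro inexact_newton_grad[OF \<mu> _ s_le]) simp_all
  have "?g \<bullet> s \<le> 0"
    using iterate_curvature_le[of n] nonneg[of s] by (simp add: s)
  then have "\<rho> * (?g \<bullet> s) \<le> 0"
    using \<rho>(1) by (rule mult_nonneg_nonpos[rotated])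
  then show "f (x + s) \<le> f x"
    using suff by (simp add: sufficient_def)
qed

end

section \<open>Iteration count\<close>

text \<open>Taking logarithms twice; \<open>C > \<epsilon>\<close> makes the inner one
  positive.\<close>

lemma double_exp_le:
  fixes C \<theta> \<epsilon> :: real
  assumes "0 < C" "0 < \<theta>" "\<theta> < 1" "0 < \<epsilon>" "log 2 (ln (C / \<epsilon>) / ln (1 / \<theta>)) \<le> real n" "C > \<epsilon>"
  shows "C * \<theta> ^ (2 ^ n) \<le> \<epsilon>"
proof -
  have c: "ln (1 / \<theta>) > 0" using assms by simp
  have "ln (C / \<epsilon>) > 0" using assms by simp
  then have "ln (C / \<epsilon>) / ln (1 / \<theta>) \<le> 2 powr real n"
    using assms(5) c by (simp add: log_le_iff)
  then have "ln (C / \<epsilon>) \<le> 2 ^ n * ln (1 / \<theta>)"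
    using c by (simp add: powr_realpow pos_divide_le_eq)
  also have "\<dots> = ln ((1 / \<theta>) ^ (2 ^ n))"
    using assms by (subst ln_realpow) simp_all
  finally have "C / \<epsilon> \<le> (1 / \<theta>) ^ (2 ^ n)"
    using assms by (subst (asm) ln_le_cancel_iff) simp_all
  then show ?thesis
    using assms by (simp add: power_divide field_simps)
qed

text \<open>Ensures that the \<open>LEAST\<close> defining the iteration count is attained.\<close>

lemma ex_double_exp_le:
  fixes C \<theta> \<epsilon> :: real
  assumes "0 < C" "0 < \<theta>" "\<theta> < 1" "0 < \<epsilon>"
  shows "\<exists>n. C * \<theta> ^ (2 ^ n) \<le> \<epsilon>"
proof -
  have "(\<lambda>n. \<theta> ^ (2 ^ n)) \<longlonglongrightarrow> 0"
    using LIMSEQ_subseq_LIMSEQ[OF LIMSEQ_realpow_zero[of \<theta>], of "\<lambda>n. 2 ^ n"] assms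
    by (simp add: strict_mono_def comp_def)
  then have "(\<lambda>n. C * \<theta> ^ (2 ^ n)) \<longlonglongrightarrow> 0"
    by (rule tendsto_mult_right_zero)
  then have "eventually (\<lambda>n. C * \<theta> ^ (2 ^ n) < \<epsilon>) sequentially"
    using assms(4) by (rule order_tendstoD)
  then show ?thesis
    by (auto simp: eventually_sequentially intro: less_imp_le)
qed

text \<open>The index from \<open>double_exp_le\<close>, rounded up, bounds the least one. Constants
  inside the iterated logarithm do not change its order as \<open>\<epsilon>\<close> tends to
  \<open>0\<close>.\<close>

lemma double_exp_count_bigo:
  fixes C \<theta> K :: real
  assumes "0 < C" "0 < \<theta>" "\<theta> < 1" "0 < K"
  shows "(\<lambda>\<epsilon>. real (LEAST n. C * \<theta> ^ (2 ^ n) \<le> \<epsilon>)) \<in> O[at_right 0](\<lambda>\<epsilon>. ln (ln (K / \<epsilon>)))"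
proof -
  define c where "c = ln (1 / \<theta>)"
  have c: "c > 0" using assms by (simp add: c_def)
  \<comment> \<open>Makes the outer logarithm positive, so that rounding up adds at most
    one.\<close>
  have "eventually (\<lambda>\<epsilon>. ln (C / \<epsilon>) / c > 1) (at_right 0)"
    using assms(1) c by real_asymp
  moreover have "eventually (\<lambda>\<epsilon>. 0 < \<epsilon> \<and> \<epsilon> < C) (at_right 0)"
    unfolding eventually_at_right_field using assms(1) by blast
  ultimately have "eventually (\<lambda>\<epsilon>. norm (real (LEAST n. C * \<theta> ^ (2 ^ n) \<le> \<epsilon>))
      \<le> 1 * norm (log 2 (ln (C / \<epsilon>) / c) + 1)) (at_right 0)"
  proof eventually_elim
    case (elim \<epsilon>)
    let ?y = "log 2 (ln (C / \<epsilon>) / c)"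
    have "?y > 0" using elim by simp
    have "C * \<theta> ^ (2 ^ nat \<lceil>?y\<rceil>) \<le> \<epsilon>"
      using assms elim by (intro double_exp_le) (auto simp: c_def real_nat_ceiling_ge)
    then have "(LEAST n. C * \<theta> ^ (2 ^ n) \<le> \<epsilon>) \<le> nat \<lceil>?y\<rceil>"
      by (rule Least_le)
    then have "real (LEAST n. C * \<theta> ^ (2 ^ n) \<le> \<epsilon>) \<le> real (nat \<lceil>?y\<rceil>)"
      by simp
    also have "\<dots> \<le> ?y + 1"
      using \<open>?y > 0\<close> by linarith
    finally show ?case using \<open>?y > 0\<close> by simp
  qed
  then have "(\<lambda>\<epsilon>. real (LEAST n. C * \<theta> ^ (2 ^ n) \<le> \<epsilon>)) \<in> O[at_right 0](\<lambda>\<epsilon>. log 2 (ln (C / \<epsilon>) / c) + 1)"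
    by (rule bigoI)
  also have "(\<lambda>\<epsilon>. log 2 (ln (C / \<epsilon>) / c) + 1) \<in> O[at_right 0](\<lambda>\<epsilon>. ln (ln (K / \<epsilon>)))"
    using assms(1,4) c by real_asymp
  finally show ?thesis .
qed

theorem theorem1:
  fixes f :: "real ^ 'n \<Rightarrow> real"
    and x\<^sub>0 :: "real ^ 'n"
    and \<mu> L \<rho> \<zeta> r H\<^sub>0 \<kappa> :: real
    and T Tmax :: "nat \<Rightarrow> nat"
    and \<omega> :: "nat \<Rightarrow> real"
    and x :: "nat \<Rightarrow> real ^ 'n"
    and \<delta> :: "nat \<Rightarrow> real"
    and params_ok :: "nat \<Rightarrow> bool"
    and N :: "real \<Rightarrow> nat"
  assumes "\<mu> > 0" and "strongly_convex \<mu> f"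
    and "twice_continuously_differentiable f"
    and "L > 0" and "lipschitz_hessian L f"
    and "1 / 3 < \<rho>" and "\<rho> < 1 / 2"
    and "0 < \<zeta>" and "\<zeta> < 1"
    and "r = 3 * (1 - 2 * \<rho>) * \<mu>\<^sup>2 / L" and "norm (grad f x\<^sub>0) \<le> r"
    and "H\<^sub>0 > 0" and "\<And>y. f y \<le> f x\<^sub>0 \<Longrightarrow> spectral_norm (hessian f y) \<le> H\<^sub>0"
    and "\<kappa> = H\<^sub>0 / \<mu>"
    and "\<And>k. 1 \<le> T k \<and> T k \<le> Tmax k \<and> Tmax k \<le> CARD('n)"
    and "\<And>k. 0 \<le> \<omega> k \<and> \<omega> k < 1"
    and "\<And>k. x k = fncr_ls f (hessian f) \<rho> \<zeta> T Tmax \<omega> x\<^sub>0 k"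
    and "\<And>k. \<delta> k = f (x k) - (INF y. f y)"
    and "\<And>k. params_ok k \<longleftrightarrow>
           \<omega> k < norm (grad f (x k)) * L / (2 * \<mu>\<^sup>2) \<and>
           int (T k) \<ge> \<lceil>sqrt \<kappa> / 2 * ln (4 * \<mu>\<^sup>2 / (norm (grad f (x k)) * L))\<rceil>"
    and "\<And>\<epsilon>. N \<epsilon> = (LEAST n. (\<mu>\<^sup>2 / L)\<^sup>2 * ((3 * (1 - 2 * \<rho>)) ^ (2 ^ n) / (2 * \<mu>)) \<le> \<epsilon>)"
  shows "(\<forall>k. (\<forall>j\<le>k. grad f (x j) \<noteq> 0 \<and> params_ok j) \<longrightarrow>
            \<delta> (Suc k) < (\<mu>\<^sup>2 / L)\<^sup>2 * ((3 * (1 - 2 * \<rho>)) ^ (2 ^ (k + 1)) / (2 * \<mu>)))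
       \<and> (\<lambda>\<epsilon>. real (N \<epsilon>)) \<in> O[at_right 0](\<lambda>\<epsilon>. ln (ln (\<mu> ^ 3 / (L * \<epsilon>))))
       \<and> (\<forall>\<epsilon>. 0 < \<epsilon> \<and> \<epsilon> < 1 \<and> (\<forall>k<N \<epsilon>. \<not> suboptimal f \<epsilon> (x k) \<longrightarrow> params_ok k) \<longrightarrow>
            (\<exists>k\<le>N \<epsilon>. suboptimal f \<epsilon> (x k)))"
proof -
  \<comment> \<open>\<open>\<theta>\<close> is \<open>r\<close> in units of
    \<open>\<mu>\<^sup>2 / L\<close>, below \<open>1\<close> since \<open>\<rho> > 1 / 3\<close>;
    \<open>C\<close> is the suboptimality bound at gradient norm
    \<open>\<mu>\<^sup>2 / L\<close>.\<close>
  define \<theta> where "\<theta> = 3 * (1 - 2 * \<rho>)"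
  define C where "C = (\<mu>\<^sup>2 / L)\<^sup>2 / (2 * \<mu>)"
  note \<mu> = assms(1) and sc = assms(2) and L = assms(4)
  have \<theta>: "0 < \<theta>" "\<theta> < 1" using assms(6,7) by (auto simp: \<theta>_def)
  have C: "C > 0" using \<mu> L by (simp add: C_def)
  have bound_eq: "(\<mu>\<^sup>2 / L)\<^sup>2 * ((3 * (1 - 2 * \<rho>)) ^ m / (2 * \<mu>)) = C * \<theta> ^ m" for m
    by (simp add: C_def \<theta>_def)
  have N_eq: "N \<epsilon> = (LEAST n. C * \<theta> ^ (2 ^ n) \<le> \<epsilon>)" for \<epsilon>
    unfolding assms(20) bound_eq ..
  interpret hessian_lipschitz f L
    using assms(3,5) by unfold_locales
  have invariant: "norm (grad f (x k)) \<le> \<mu>\<^sup>2 / L * \<theta> ^ (2 ^ k) \<and> f (x k) \<le> f x\<^sub>0"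
    if "\<forall>j<k. grad f (x j) \<noteq> 0 \<and> params_ok j" for k
    using that
  proof (induction k)
    case 0
    then show ?case
      using assms(10,11) by (simp add: assms(17) \<theta>_def field_simps)
  next
    case (Suc k)
    let ?g = "grad f (x k)"
    have IH: "norm ?g \<le> \<mu>\<^sup>2 / L * \<theta> ^ (2 ^ k)" "f (x k) \<le> f x\<^sub>0"
      using Suc by auto
    have g0: "?g \<noteq> 0" and ok: "params_ok k"
      using Suc.prems by auto
    define s where "s = fst (inner_solver f \<rho> (T k) (Tmax k) (\<omega> k) (x k) (hessian f (x k)))"
    \<comment> \<open>The gradient stays within the initial radius \<open>r\<close>, as
      \<open>inner_solver_step\<close> requires.\<close>
    have "\<theta> ^ (2 ^ k) \<le> \<theta>"
      using \<theta> power_decreasing[of 1 "2 ^ k" \<theta>] by simp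
    then have "\<mu>\<^sup>2 / L * \<theta> ^ (2 ^ k) \<le> \<mu>\<^sup>2 / L * \<theta>"
      using L by (intro mult_left_mono) auto
    then have g: "norm ?g \<le> 3 * (1 - 2 * \<rho>) * \<mu>\<^sup>2 / L"
      using IH(1) by (simp add: \<theta>_def mult_ac)
    have "sqrt \<kappa> / 2 * ln (4 * \<mu>\<^sup>2 / (norm ?g * L)) \<le> real (T k)"
      using ok unfolding assms(19) by (simp add: ceiling_le_iff)
    then have T: "sqrt (H\<^sub>0 / \<mu>) / 2 * ln (4 * \<mu>\<^sup>2 / (norm ?g * L)) \<le> real (T k)"
      by (simp only: assms(14))
    have \<omega>: "\<omega> k \<le> norm ?g * L / (2 * \<mu>\<^sup>2)"
      using ok unfolding assms(19) by simp
    have Tm: "T k \<le> Tmax k" using assms(15) by blast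
    have \<rho>: "0 \<le> \<rho>" "\<rho> \<le> 1 / 2" using assms(6,7) by auto
    note step = inner_solver_step[OF sc \<mu> L \<rho> g0 g assms(13)[OF IH(2)] Tm T \<omega>, folded s_def]
    have x_Suc: "x (Suc k) = x k + s"
      using g0 backtrack_eq[OF step(1), of \<zeta>] by (simp add: assms(17) Let_def s_def)
    have "norm (grad f (x (Suc k))) \<le> L / \<mu>\<^sup>2 * (norm ?g)\<^sup>2"
      using step(2) by (simp add: x_Suc)
    also have "\<dots> \<le> L / \<mu>\<^sup>2 * (\<mu>\<^sup>2 / L * \<theta> ^ (2 ^ k))\<^sup>2"
      using L IH(1) by (intro mult_left_mono power_mono) auto
    also have "\<dots> = \<mu>\<^sup>2 / L * \<theta> ^ (2 ^ Suc k)"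
      using L \<mu> by (simp add: power_mult_distrib power_divide power2_eq_square flip: power_add)
        (simp add: mult_2)
    finally show ?case
      using step(3) IH(2) by (simp add: x_Suc)
  qed
  \<comment> \<open>Squaring the gradient norm doubles the exponent once more. The surplus over
    \<open>2 ^ k\<close> is what makes \<open>rate\<close> strict.\<close>
  have \<delta>_le: "\<delta> k \<le> C * \<theta> ^ (2 ^ Suc k)" if "\<forall>j<k. grad f (x j) \<noteq> 0 \<and> params_ok j" for k
  proof -
    have "\<delta> k \<le> (norm (grad f (x k)))\<^sup>2 / (2 * \<mu>)"
      unfolding assms(18) by (rule suboptimality_le[OF sc \<mu>])
    also have "\<dots> \<le> (\<mu>\<^sup>2 / L * \<theta> ^ (2 ^ k))\<^sup>2 / (2 * \<mu>)"
      using \<mu> invariant[OF that] by (intro divide_right_mono power_mono) auto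
    also have "\<dots> = C * \<theta> ^ (2 ^ Suc k)"
    proof -
      have "(\<theta> ^ (2 ^ k))\<^sup>2 = \<theta> ^ (2 ^ Suc k)"
        by (simp add: mult.commute flip: power_mult)
      then show ?thesis by (simp only: C_def power_mult_distrib) (rule times_divide_eq_left[symmetric])
    qed
    finally show ?thesis .
  qed
  have \<theta>_decr: "C * \<theta> ^ (2 ^ Suc k) < C * \<theta> ^ (2 ^ k)" for k
    using \<theta> C power_strict_decreasing[of "2 ^ k" "2 ^ Suc k" \<theta>] by (intro mult_strict_left_mono) auto
  have rate: "\<delta> (Suc k) < C * \<theta> ^ (2 ^ (k + 1))" if "\<forall>j\<le>k. grad f (x j) \<noteq> 0 \<and> params_ok j" for k
    using \<delta>_le[of "Suc k"] \<theta>_decr[of "Suc k"] that by (simp add: less_Suc_eq_le)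
  have "\<mu> ^ 3 / L > 0" using \<mu> L by simp
  then have bigo: "(\<lambda>\<epsilon>. real (N \<epsilon>)) \<in> O[at_right 0](\<lambda>\<epsilon>. ln (ln (\<mu> ^ 3 / (L * \<epsilon>))))"
    using double_exp_count_bigo[OF C \<theta>, of "\<mu> ^ 3 / L"] by (simp add: N_eq)
  \<comment> \<open>If no iterate up to \<open>N \<epsilon>\<close> is suboptimal, the parameter
    conditions hold before \<open>N \<epsilon>\<close> and no gradient there vanishes, so
    \<open>\<delta>_le\<close> applies at \<open>N \<epsilon>\<close>.\<close>
  have "\<exists>k\<le>N \<epsilon>. suboptimal f \<epsilon> (x k)"
    if \<epsilon>: "0 < \<epsilon>" and ok: "\<forall>k<N \<epsilon>. \<not> suboptimal f \<epsilon> (x k) \<longrightarrow> params_ok k" for \<epsilon>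
  proof (rule ccontr)
    assume "\<not> ?thesis"
    then have not_sub: "\<not> suboptimal f \<epsilon> (x k)" if "k \<le> N \<epsilon>" for k
      using that by blast
    have "grad f (x k) \<noteq> 0" if "k < N \<epsilon>" for k
    proof
      assume "grad f (x k) = 0"
      then have "f (x k) - (INF y. f y) \<le> 0"
        using suboptimality_le[OF sc \<mu>, of "x k"] by simp
      then show False
        using not_sub[of k] that \<epsilon> by (simp add: suboptimal_def)
    qed
    then have "\<delta> (N \<epsilon>) \<le> C * \<theta> ^ (2 ^ Suc (N \<epsilon>))"
      using ok not_sub by (intro \<delta>_le) auto
    also have "\<dots> \<le> C * \<theta> ^ (2 ^ N \<epsilon>)"
      using \<theta>_decr by (rule less_imp_le)
    also have "\<dots> \<le> \<epsilon>"
      unfolding N_eq using ex_double_exp_le[OF C \<theta> \<epsilon>] by (rule LeastI_ex)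
    finally show False
      using not_sub[of "N \<epsilon>"] by (simp add: suboptimal_def assms(18))
  qed
  then show ?thesis
    unfolding bound_eq using rate bigo by blast
qed

end
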